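(* There exists a $\Delta^0_2$ partition $A_0\cup A_1=2^{<\omega}$ with the following property. For every (not necessarily computable) partition $B_0\cup B_1=\omega$, there is an infinite set $H$ with $H\subseteq B_0$ or $H\subseteq B_1$ such that $H$ does not compute any set $S\subseteq 2^{<\omega}$ with $S\cong 2^{<\omega}$ and ($S\subseteq A_0$ or $S\subseteq A_1$).
   Context: A set $S\subseteq 2^{<\omega}$ is order isomorphic to $2^{<\omega}$ (written $S\cong 2^{<\omega}$) if there is a bijection $g:2^{<\omega}\to S$ such that, for all $\sigma,\tau\in 2^{<\omega}$, $\sigma\preceq\tau$ if and only if $g(\sigma)\preceq g(\tau)$. Here $\preceq$ is the prefix relation on binary strings. *)

theory Defs
  imports "HOL-Library.Nat_Bijection" "HOL-Library.Sublist"
begin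

datatype rf = Zr | Sc | Idf | Fs | Sn | Orc | Cn rf rf | Pr rf rf | Rc rf rf | Mn rf

inductive ev :: "(nat \<Rightarrow> nat) \<Rightarrow> rf \<Rightarrow> nat \<Rightarrow> nat \<Rightarrow> bool" for orc where
  ev_Zr: "ev orc Zr x 0"
| ev_Sc: "ev orc Sc x (Suc x)"
| ev_Idf: "ev orc Idf x x"
| ev_Fs: "ev orc Fs x (fst (prod_decode x))"
| ev_Sn: "ev orc Sn x (snd (prod_decode x))"
| ev_Orc: "ev orc Orc x (orc x)"
| ev_Cn: "ev orc g x y \<Longrightarrow> ev orc f y z \<Longrightarrow> ev orc (Cn f g) x z"
| ev_Pr: "ev orc f x y \<Longrightarrow> ev orc g x z \<Longrightarrow> ev orc (Pr f g) x (prod_encode (y, z))"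
| ev_Rc0: "ev orc f x y \<Longrightarrow> ev orc (Rc f g) (prod_encode (x, 0)) y"
| ev_RcS: "ev orc (Rc f g) (prod_encode (x, n)) y \<Longrightarrow>
           ev orc g (prod_encode (x, prod_encode (n, y))) z \<Longrightarrow>
           ev orc (Rc f g) (prod_encode (x, Suc n)) z"
| ev_Mn: "ev orc f (prod_encode (x, n)) 0 \<Longrightarrow>
          (\<forall>m<n. \<exists>k. 0 < k \<and> ev orc f (prod_encode (x, m)) k) \<Longrightarrow>
          ev orc (Mn f) x n"

definition chi :: "nat set \<Rightarrow> nat \<Rightarrow> nat" where
  "chi X n = (if n \<in> X then 1 else 0)"

definition turing_le :: "nat set \<Rightarrow> nat set \<Rightarrow> bool" where
  "turing_le X Y \<longleftrightarrow> (\<exists>p. \<forall>x. ev (chi Y) p x (chi X x))"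

definition computable :: "nat set \<Rightarrow> bool" where
  "computable X \<longleftrightarrow> turing_le X {}"

definition Sigma2 :: "nat set \<Rightarrow> bool" where
  "Sigma2 A \<longleftrightarrow> (\<exists>R. computable R \<and>
     (\<forall>x. x \<in> A \<longleftrightarrow> (\<exists>y. \<forall>z. prod_encode (x, prod_encode (y, z)) \<in> R)))"

definition Delta2 :: "nat set \<Rightarrow> bool" where
  "Delta2 A \<longleftrightarrow> Sigma2 A \<and> Sigma2 (- A)"

section \<open>Binary strings coded as natural numbers (bijective base-2 coding)\<close>

fun scode :: "bool list \<Rightarrow> nat" where
  "scode [] = 0"
| "scode (b # s) = 2 * scode s + (if b then 2 else 1)"

definition codeset :: "bool list set \<Rightarrow> nat set" where
  "codeset S = scode ` S"

definition tree_iso :: "bool list set \<Rightarrow> bool" where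
  "tree_iso S \<longleftrightarrow> (\<exists>g :: bool list \<Rightarrow> bool list. bij_betw g UNIV S \<and>
     (\<forall>\<sigma> \<tau>. prefix \<sigma> \<tau> \<longleftrightarrow> prefix (g \<sigma>) (g \<tau>)))"

end

theory Submission
  imports Defs "HOL-Library.Infinite_Set"
begin

text \<open>
  Idea. Let h be an increasing 0'-computable sequence such that, for every computable function f,
  h (n + 1) exceeds f (h n) for almost all n. On the strings with code in (h n, h (n + 1)], the
  partition copies the clopen set coded by the first component of n. So, for every
  finite set V of strings and every computable f, there is an l such that on (l, f l] a string has
  colour 1 exactly if it extends an element of V.

  Given a partition (B, - B), Mathias forcing with reservoirs computable from oracles all of whose
  functions are computably dominated produces an infinite subset of each of the two sides. To defeat
  a pair of programs, one for each side, first let them enumerate incomparable strings a and b.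
  If for some splitting (Z, - Z) of the reservoir and some l no finite extension inside Z makes the
  first program enumerate a string above a of code greater than l, and none inside - Z does so for
  the second program and b, then by the hyperimmune-free basis theorem Z can be chosen
  computably dominated, and shrinking the reservoir to Z or to - Z prevents one of the programs from
  computing a copy of the full tree. Otherwise compactness gives a computable bound f l on the
  search for such extensions, valid for all Z simultaneously and in particular for Z = B; at an l
  where the partition gives the cones above a and b the wrong colours on (l, f l], one of the
  programs is forced to enumerate a string of the wrong colour.
\<close>

section \<open>Functions computable from an oracle\<close>

definition pair :: "nat \<Rightarrow> nat \<Rightarrow> nat" where
  "pair x y = prod_encode (x, y)"

definition pfst :: "nat \<Rightarrow> nat" where
  "pfst z = fst (prod_decode z)"

definition psnd :: "nat \<Rightarrow> nat" where
  "psnd z = snd (prod_decode z)"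

lemma pfst_pair [simp]: "pfst (pair x y) = x"
  and psnd_pair [simp]: "psnd (pair x y) = y"
  and pair_collapse [simp]: "pair (pfst z) (psnd z) = z"
  by (simp_all add: pair_def pfst_def psnd_def)

lemma pair_inject [simp]: "pair x y = pair x' y' \<longleftrightarrow> x = x' \<and> y = y'"
  by (simp add: pair_def)

lemma le_pair1: "x \<le> pair x y" and le_pair2: "y \<le> pair x y"
  by (simp_all add: pair_def le_prod_encode_1 le_prod_encode_2)

definition comp_in :: "(nat \<Rightarrow> nat) \<Rightarrow> (nat \<Rightarrow> nat) \<Rightarrow> bool" where
  "comp_in orc f \<longleftrightarrow> (\<exists>p. \<forall>x. ev orc p x (f x))"

definition dec_in :: "(nat \<Rightarrow> nat) \<Rightarrow> (nat \<Rightarrow> bool) \<Rightarrow> bool" where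
  "dec_in orc P \<longleftrightarrow> comp_in orc (\<lambda>x. of_bool (P x))"

section \<open>Closure properties of relative computability\<close>

lemma comp_in_compose:
  assumes "comp_in orc f" "comp_in orc g"
  shows "comp_in orc (\<lambda>x. f (g x))"
  using assms unfolding comp_in_def by (meson ev_Cn)

lemma dec_in_compose:
  assumes "dec_in orc P" "comp_in orc g"
  shows "dec_in orc (\<lambda>x. P (g x))"
  using assms unfolding dec_in_def by (rule comp_in_compose)

lemma comp_in_id: "comp_in orc (\<lambda>x. x)"
  unfolding comp_in_def by (meson ev_Idf)

lemma comp_in_Suc: "comp_in orc f \<Longrightarrow> comp_in orc (\<lambda>x. Suc (f x))"
  unfolding comp_in_def by (meson ev_Cn ev_Sc)

lemma comp_in_const: "comp_in orc (\<lambda>x. n)"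
proof (induction n)
  case 0
  then show ?case unfolding comp_in_def by (meson ev_Zr)
qed (rule comp_in_Suc)

lemma comp_in_oracle: "comp_in orc f \<Longrightarrow> comp_in orc (\<lambda>x. orc (f x))"
  unfolding comp_in_def by (meson ev_Cn ev_Orc)

lemma comp_in_pfst: "comp_in orc f \<Longrightarrow> comp_in orc (\<lambda>x. pfst (f x))"
  unfolding comp_in_def pfst_def by (meson ev_Cn ev_Fs)

lemma comp_in_psnd: "comp_in orc f \<Longrightarrow> comp_in orc (\<lambda>x. psnd (f x))"
  unfolding comp_in_def psnd_def by (meson ev_Cn ev_Sn)

lemma comp_in_pair:
  "comp_in orc f \<Longrightarrow> comp_in orc g \<Longrightarrow> comp_in orc (\<lambda>x. pair (f x) (g x))"
  unfolding comp_in_def pair_def by (meson ev_Pr)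

text \<open>The nested pair mirrors the argument format of \<open>Rc\<close>. Sums, products,
  powers, differences and bounded quantifiers are obtained below by writing them with
  \<open>rec_nat\<close>.\<close>

lemma comp_in_rec:
  assumes "comp_in orc f" "comp_in orc (\<lambda>w. g (pfst w) (pfst (psnd w)) (psnd (psnd w)))"
    and "comp_in orc k"
  shows "comp_in orc (\<lambda>x. rec_nat (f x) (g x) (k x))"
proof -
  obtain p where p: "\<And>x. ev orc p x (f x)"
    using assms(1) unfolding comp_in_def by blast
  obtain q where q: "\<And>x. ev orc q x (g (pfst x) (pfst (psnd x)) (psnd (psnd x)))"
    using assms(2) unfolding comp_in_def by blast
  have "ev orc (Rc p q) (prod_encode (x, n)) (rec_nat (f x) (g x) n)" for x n
  proof (induction n)
    case 0
    then show ?case by (simp add: ev_Rc0 p)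
  next
    case (Suc n)
    let ?r = "rec_nat (f x) (g x) n"
    have "ev orc q (pair x (pair n ?r)) (g x n ?r)"
      using q[of "pair x (pair n ?r)"] by simp
    with Suc show ?case by (simp add: ev_RcS pair_def)
  qed
  then have "comp_in orc (\<lambda>w. rec_nat (f (pfst w)) (g (pfst w)) (psnd w))"
    unfolding comp_in_def by (metis pair_collapse pair_def)
  from comp_in_compose[OF this comp_in_pair[OF comp_in_id assms(3)]] show ?thesis
    by simp
qed

lemma comp_in_add:
  assumes "comp_in orc f" "comp_in orc g"
  shows "comp_in orc (\<lambda>x. f x + g x)"
proof -
  have "rec_nat a (\<lambda>_. Suc) b = a + b" for a b by (induction b) auto
  moreover have "comp_in orc (\<lambda>x. rec_nat (f x) (\<lambda>_. Suc) (g x))"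
    by (intro comp_in_rec assms comp_in_Suc comp_in_psnd comp_in_id)
  ultimately show ?thesis by simp
qed

lemma comp_in_mult:
  assumes "comp_in orc f" "comp_in orc g"
  shows "comp_in orc (\<lambda>x. f x * g x)"
proof -
  have "rec_nat 0 (\<lambda>_ y. a + y) b = a * b" for a b :: nat by (induction b) auto
  moreover have "comp_in orc (\<lambda>x. rec_nat 0 (\<lambda>_ y. f x + y) (g x))"
    by (intro comp_in_rec assms comp_in_add comp_in_psnd comp_in_id comp_in_const
        comp_in_compose[OF assms(1) comp_in_pfst])
  ultimately show ?thesis by simp
qed

lemma comp_in_pow2:
  assumes "comp_in orc g"
  shows "comp_in orc (\<lambda>x. 2 ^ g x)"
proof -
  have "rec_nat 1 (\<lambda>_ y. y + y) b = (2::nat) ^ b" for b :: nat by (induction b) auto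
  moreover have "comp_in orc (\<lambda>x. rec_nat 1 (\<lambda>_ y. y + y) (g x))"
    by (intro comp_in_rec assms comp_in_add comp_in_psnd comp_in_id comp_in_const)
  ultimately show ?thesis by simp
qed

lemma comp_in_diff:
  assumes "comp_in orc f" "comp_in orc g"
  shows "comp_in orc (\<lambda>x. f x - g x)"
proof -
  \<comment> \<open>This recursion is the predecessor, with value 0 at 0; truncated subtraction
    iterates it.\<close>
  have pred: "comp_in orc (\<lambda>x. rec_nat 0 (\<lambda>n _. n) x)"
    by (intro comp_in_rec comp_in_const comp_in_pfst comp_in_psnd comp_in_id)
  have "rec_nat a (\<lambda>_ y. rec_nat 0 (\<lambda>n _. n) y) b = a - b" for a b :: nat
  proof (induction b)
    case (Suc b)
    have "rec_nat 0 (\<lambda>n _. n) m = m - 1" for m :: nat by (cases m) auto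
    with Suc show ?case by simp
  qed simp
  moreover have "comp_in orc (\<lambda>x. rec_nat (f x) (\<lambda>_ y. rec_nat 0 (\<lambda>n _. n) y) (g x))"
    by (intro comp_in_rec assms comp_in_psnd comp_in_id comp_in_compose[OF pred])
  ultimately show ?thesis by simp
qed

lemma dec_in_not: "dec_in orc P \<Longrightarrow> dec_in orc (\<lambda>x. \<not> P x)"
proof -
  assume "dec_in orc P"
  moreover have "(of_bool (\<not> b) :: nat) = 1 - of_bool b" for b by simp
  ultimately show ?thesis unfolding dec_in_def by (simp only: comp_in_diff comp_in_const)
qed

lemma dec_in_conj: "dec_in orc P \<Longrightarrow> dec_in orc Q \<Longrightarrow> dec_in orc (\<lambda>x. P x \<and> Q x)"
  unfolding dec_in_def
  by (simp add: of_bool_conj comp_in_mult)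

lemma dec_in_disj: "dec_in orc P \<Longrightarrow> dec_in orc Q \<Longrightarrow> dec_in orc (\<lambda>x. P x \<or> Q x)"
  using dec_in_not[OF dec_in_conj[OF dec_in_not dec_in_not, of orc P Q]] by simp

lemma dec_in_imp: "dec_in orc P \<Longrightarrow> dec_in orc Q \<Longrightarrow> dec_in orc (\<lambda>x. P x \<longrightarrow> Q x)"
  unfolding imp_conv_disj by (intro dec_in_disj dec_in_not)

lemma dec_in_eq_0: "comp_in orc f \<Longrightarrow> dec_in orc (\<lambda>x. f x = 0)"
proof -
  assume "comp_in orc f"
  moreover have "of_bool (n = 0) = 1 - n" for n :: nat by auto
  ultimately show ?thesis unfolding dec_in_def by (simp add: comp_in_diff comp_in_const)
qed

lemma dec_in_le: "comp_in orc f \<Longrightarrow> comp_in orc g \<Longrightarrow> dec_in orc (\<lambda>x. f x \<le> g x)"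
  using dec_in_eq_0[OF comp_in_diff, of orc f g] by simp

lemma dec_in_less: "comp_in orc f \<Longrightarrow> comp_in orc g \<Longrightarrow> dec_in orc (\<lambda>x. f x < g x)"
  using dec_in_not[OF dec_in_le, of orc g f] by (simp add: not_le)

lemma dec_in_eq:
  fixes f g :: "nat \<Rightarrow> nat"
  shows "comp_in orc f \<Longrightarrow> comp_in orc g \<Longrightarrow> dec_in orc (\<lambda>x. f x = g x)"
  using dec_in_conj[OF dec_in_le dec_in_le, of orc f g g f] by (simp add: eq_iff)

lemma comp_in_if:
  assumes "dec_in orc P" "comp_in orc f" "comp_in orc g"
  shows "comp_in orc (\<lambda>x. if P x then f x else g x)"
proof -
  have "(if P x then f x else g x) = of_bool (P x) * f x + of_bool (\<not> P x) * g x" for x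
    by simp
  then show ?thesis
    using assms dec_in_not[OF assms(1)]
    by (simp only: dec_in_def comp_in_add comp_in_mult)
qed

lemma dec_in_const: "dec_in orc (\<lambda>x. b)"
  unfolding dec_in_def by (rule comp_in_const)

lemma dec_in_ex:
  assumes "comp_in orc f" "dec_in orc (\<lambda>w. P (pfst w) (psnd w))"
  shows "dec_in orc (\<lambda>x. \<exists>i<f x. P x i)"
proof -
  have "rec_nat 0 (\<lambda>i y. if P x i then 1 else y) n = (of_bool (\<exists>i<n. P x i) :: nat)" for x n
    by (induction n) (auto simp: less_Suc_eq)
  moreover have "comp_in orc (\<lambda>x. rec_nat 0 (\<lambda>i y. if P x i then 1 else y) (f x))"
  proof (intro comp_in_rec assms comp_in_if comp_in_const comp_in_psnd comp_in_id)
    show "dec_in orc (\<lambda>x. P (pfst x) (pfst (psnd x)))"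
      using dec_in_compose[OF assms(2), of "\<lambda>w. pair (pfst w) (pfst (psnd w))"]
      by (simp add: comp_in_pair comp_in_pfst comp_in_psnd comp_in_id)
  qed
  ultimately show ?thesis unfolding dec_in_def by simp
qed

lemma dec_in_all:
  assumes "comp_in orc f" "dec_in orc (\<lambda>w. P (pfst w) (psnd w))"
  shows "dec_in orc (\<lambda>x. \<forall>i<f x. P x i)"
  using dec_in_not[OF dec_in_ex[OF assms(1), of "\<lambda>x i. \<not> P x i"]] dec_in_not[OF assms(2)]
  by simp

lemma comp_in_Least:
  assumes "dec_in orc (\<lambda>w. P (pfst w) (psnd w))" "\<And>x. \<exists>n. P x n"
  shows "comp_in orc (\<lambda>x. LEAST n. P x n)"
proof -
  \<comment> \<open>Minimisation searches for the value 0, so \<open>q\<close> decides the negation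
    of \<open>P\<close>.\<close>
  obtain q where q: "\<And>w. ev orc q w (of_bool (\<not> P (pfst w) (psnd w)))"
    using dec_in_not[OF assms(1)] unfolding dec_in_def comp_in_def by blast
  have "ev orc (Mn q) x (LEAST n. P x n)" for x
  proof (rule ev_Mn)
    have "P x (LEAST n. P x n)" by (rule LeastI_ex) (rule assms(2))
    then show "ev orc q (prod_encode (x, LEAST n. P x n)) 0"
      using q[of "pair x (LEAST n. P x n)"] by (simp add: pair_def[symmetric])
    have "ev orc q (prod_encode (x, m)) 1" if "m < (LEAST n. P x n)" for m
      using q[of "pair x m"] not_less_Least[OF that] by (simp add: pair_def[symmetric])
    then show "\<forall>m<(LEAST n. P x n). \<exists>k>0. ev orc q (prod_encode (x, m)) k"
      using zero_less_one by blast
  qed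
  then show ?thesis unfolding comp_in_def by blast
qed

text \<open>Bit \<open>i\<close> of \<open>z\<close> is the parity of \<open>z div 2 ^ i\<close>.
  Naming the quotient and the remainder by bounded quantifiers leaves only sums, products and
  powers.\<close>

lemma mem_set_decode_iff:
  "i \<in> set_decode z \<longleftrightarrow> (\<exists>q<Suc z. \<exists>r<2 ^ i. z = (q + q + 1) * 2 ^ i + r)"
proof
  assume "i \<in> set_decode z"
  then have "odd (z div 2 ^ i)" by (simp add: set_decode_def)
  then obtain q where q: "z div 2 ^ i = 2 * q + 1" by (elim oddE)
  then have "z = (q + q + 1) * 2 ^ i + z mod 2 ^ i"
    by (metis div_mult_mod_eq mult_2)
  moreover have "q < Suc z"
    using q div_le_dividend[of z "2 ^ i"] by linarith
  ultimately show "\<exists>q<Suc z. \<exists>r<2 ^ i. z = (q + q + 1) * 2 ^ i + r"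
    by (intro exI[of _ q] exI[of _ "z mod 2 ^ i"] conjI) simp_all
next
  assume "\<exists>q<Suc z. \<exists>r<2 ^ i. z = (q + q + 1) * 2 ^ i + r"
  then obtain q r where "r < 2 ^ i" "z = (q + q + 1) * 2 ^ i + r" by blast
  then have "z div 2 ^ i = q + q + 1"
    by (intro div_nat_eqI) (simp_all add: algebra_simps)
  then show "i \<in> set_decode z" by (simp add: set_decode_def)
qed

lemma dec_in_mem_set_decode:
  assumes "comp_in orc f" "comp_in orc g"
  shows "dec_in orc (\<lambda>x. f x \<in> set_decode (g x))"
proof -
  have "dec_in orc (\<lambda>x. f x \<in> set_decode (g x)) =
    dec_in orc (\<lambda>x. \<exists>q<Suc (g x). \<exists>r<2 ^ f x. g x = (q + q + 1) * 2 ^ f x + r)"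
    by (simp only: mem_set_decode_iff)
  also have "\<dots>"
    by (intro dec_in_ex dec_in_eq comp_in_add comp_in_mult comp_in_pow2 comp_in_Suc assms
        comp_in_const comp_in_pfst comp_in_psnd comp_in_id
        comp_in_compose[OF assms(1)] comp_in_compose[OF assms(2)])
  finally show ?thesis .
qed

lemma mem_set_decode_less: "i \<in> set_decode z \<Longrightarrow> i < z"
proof -
  assume "i \<in> set_decode z"
  then have "z div 2 ^ i \<noteq> 0" by (metis even_zero mem_Collect_eq set_decode_def)
  then have "2 ^ i \<le> z" by (metis div_less not_le)
  then show ?thesis using less_exp[of i] by (rule order.strict_trans2[rotated])
qed

lemmas comp_intros = comp_in_id comp_in_const comp_in_Suc comp_in_oracle comp_in_pfst
  comp_in_psnd comp_in_pair comp_in_add comp_in_mult comp_in_pow2 comp_in_diff comp_in_if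
  dec_in_not dec_in_conj dec_in_disj dec_in_imp dec_in_le dec_in_less dec_in_eq dec_in_const
  dec_in_ex dec_in_all dec_in_mem_set_decode

section \<open>Transitivity of relative computability, and determinism of evaluation\<close>

fun rf_subst :: "rf \<Rightarrow> rf \<Rightarrow> rf" where
  "rf_subst q Orc = q"
| "rf_subst q (Cn f g) = Cn (rf_subst q f) (rf_subst q g)"
| "rf_subst q (Pr f g) = Pr (rf_subst q f) (rf_subst q g)"
| "rf_subst q (Rc f g) = Rc (rf_subst q f) (rf_subst q g)"
| "rf_subst q (Mn f) = Mn (rf_subst q f)"
| "rf_subst q p = p"

lemma ev_rf_subst:
  assumes "\<And>x. ev orc' q x (orc x)"
  shows "ev orc p x y \<Longrightarrow> ev orc' (rf_subst q p) x y"
proof (induction rule: ev.induct)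
  case (ev_Mn f x n)
  then show ?case by (auto intro!: ev.intros)
qed (auto intro: ev.intros assms)

lemma comp_in_trans:
  assumes "comp_in orc' orc" "comp_in orc f"
  shows "comp_in orc' f"
proof -
  obtain q p where "\<And>x. ev orc' q x (orc x)" "\<And>x. ev orc p x (f x)"
    using assms unfolding comp_in_def by blast
  then have "ev orc' (rf_subst q p) x (f x)" for x
    by (rule ev_rf_subst)
  then show ?thesis
    unfolding comp_in_def by blast
qed

lemma dec_in_trans: "comp_in orc' orc \<Longrightarrow> dec_in orc P \<Longrightarrow> dec_in orc' P"
  unfolding dec_in_def by (rule comp_in_trans)

inductive_cases ev_ZrE: "ev orc Zr x y"
inductive_cases ev_ScE: "ev orc Sc x y"
inductive_cases ev_IdfE: "ev orc Idf x y"
inductive_cases ev_FsE: "ev orc Fs x y"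
inductive_cases ev_SnE: "ev orc Sn x y"
inductive_cases ev_OrcE: "ev orc Orc x y"
inductive_cases ev_CnE: "ev orc (Cn f g) x y"
inductive_cases ev_PrE: "ev orc (Pr f g) x y"
inductive_cases ev_RcE: "ev orc (Rc f g) x y"
inductive_cases ev_MnE: "ev orc (Mn f) x y"

text \<open>In the case of \<open>Mn\<close>, two different results would give the searched program
  both the value 0 and a positive value at the smaller one.\<close>

lemma ev_deterministic: "ev orc p x y \<Longrightarrow> ev orc p x z \<Longrightarrow> y = z"
proof (induction arbitrary: z rule: ev.induct)
  case (ev_Mn f x n)
  from ev_Mn.prems show ?case
  proof (rule ev_MnE)
    assume "ev orc f (prod_encode (x, z)) 0"
      and "\<forall>m<z. \<exists>k>0. ev orc f (prod_encode (x, m)) k"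
    with ev_Mn.IH show "n = z"
      by (metis less_irrefl linorder_neqE_nat)
  qed
next
  case (ev_RcS f g x n y z z')
  from ev_RcS.prems obtain y' where "ev orc (Rc f g) (prod_encode (x, n)) y'"
    "ev orc g (prod_encode (x, prod_encode (n, y'))) z'"
    by (rule ev_RcE) simp_all
  with ev_RcS.IH show ?case by blast
next
  case (ev_Rc0 f x y g z)
  from ev_Rc0.prems have "ev orc f x z"
    by (rule ev_RcE) simp_all
  then show ?case by (rule ev_Rc0.IH)
next
  case (ev_Cn g x y f z)
  from ev_Cn.prems show ?case
    by (rule ev_CnE) (use ev_Cn.IH in blast)
next
  case (ev_Pr f x y g z)
  from ev_Pr.prems show ?case
    by (rule ev_PrE) (use ev_Pr.IH in blast)
qed (auto elim: ev_ZrE ev_ScE ev_IdfE ev_FsE ev_SnE ev_OrcE)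

section \<open>Computations as finite self-justified sets of triples\<close>

fun rf_code :: "rf \<Rightarrow> nat" where
  "rf_code Zr = pair 0 0"
| "rf_code Sc = pair 1 0"
| "rf_code Idf = pair 2 0"
| "rf_code Fs = pair 3 0"
| "rf_code Sn = pair 4 0"
| "rf_code Orc = pair 5 0"
| "rf_code (Cn f g) = pair 6 (pair (rf_code f) (rf_code g))"
| "rf_code (Pr f g) = pair 7 (pair (rf_code f) (rf_code g))"
| "rf_code (Rc f g) = pair 8 (pair (rf_code f) (rf_code g))"
| "rf_code (Mn f) = pair 9 (rf_code f)"

lemma inj_rf_code: "inj rf_code"
proof (rule injI)
  show "rf_code p = rf_code q \<Longrightarrow> p = q" for p q
  proof (induction p arbitrary: q)
    case (Cn f g q)
    then show ?case by (cases q) auto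
  next
    case (Pr f g q)
    then show ?case by (cases q) auto
  next
    case (Rc f g q)
    then show ?case by (cases q) auto
  next
    case (Mn f q)
    then show ?case by (cases q) auto
  qed (case_tac [!] q, auto)
qed

text \<open>Stands for the assertion that the program with code \<open>p\<close> maps
  \<open>x\<close> to \<open>y\<close>.\<close>

definition triple :: "nat \<Rightarrow> nat \<Rightarrow> nat \<Rightarrow> nat" where
  "triple p x y = pair p (pair x y)"

lemma triple_inject [simp]: "triple p x y = triple p' x' y' \<longleftrightarrow> p = p' \<and> x = x' \<and> y = y'"
  by (simp add: triple_def)

lemma le_triple: "p \<le> triple p x y" "x \<le> triple p x y" "y \<le> triple p x y"
  unfolding triple_def by (meson le_pair1 le_pair2 le_trans)+

text \<open>One local rule application: the tag of \<open>p\<close> selects the rule of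
  \<open>ev\<close>, and \<open>D\<close> supplies the premises. The relation \<open>Q\<close> lists
  the permitted oracle answers, so that queries can be restricted to an initial segment of the
  oracle.\<close>

definition step :: "(nat \<Rightarrow> nat \<Rightarrow> bool) \<Rightarrow> nat set \<Rightarrow> nat \<Rightarrow> nat \<Rightarrow> nat \<Rightarrow> bool" where
  "step Q D p x y \<longleftrightarrow>
     pfst p = 0 \<and> y = 0 \<or>
     pfst p = 1 \<and> y = Suc x \<or>
     pfst p = 2 \<and> y = x \<or>
     pfst p = 3 \<and> y = pfst x \<or>
     pfst p = 4 \<and> y = psnd x \<or>
     pfst p = 5 \<and> Q x y \<or>
     pfst p = 6 \<and> (\<exists>w. triple (psnd (psnd p)) x w \<in> D \<and> triple (pfst (psnd p)) w y \<in> D) \<or>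
     pfst p = 7 \<and> triple (pfst (psnd p)) x (pfst y) \<in> D \<and> triple (psnd (psnd p)) x (psnd y) \<in> D \<or>
     pfst p = 8 \<and> psnd x = 0 \<and> triple (pfst (psnd p)) (pfst x) y \<in> D \<or>
     pfst p = 8 \<and> 0 < psnd x \<and>
       (\<exists>w. triple p (pair (pfst x) (psnd x - 1)) w \<in> D \<and>
            triple (psnd (psnd p)) (pair (pfst x) (pair (psnd x - 1) w)) y \<in> D) \<or>
     pfst p = 9 \<and> triple (psnd p) (pair x y) 0 \<in> D \<and>
       (\<forall>m<y. \<exists>k. 0 < k \<and> triple (psnd p) (pair x m) k \<in> D)"

text \<open>No well-foundedness has to be imposed: every premise of a rule concerns a smaller program,
  or the same recursion at a smaller argument.\<close>

definition justified :: "(nat \<Rightarrow> nat \<Rightarrow> bool) \<Rightarrow> nat set \<Rightarrow> bool" where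
  "justified Q D \<longleftrightarrow> (\<forall>t\<in>D. step Q D (pfst t) (pfst (psnd t)) (psnd (psnd t)))"

lemma justifiedD: "justified Q D \<Longrightarrow> triple p x y \<in> D \<Longrightarrow> step Q D p x y"
  unfolding justified_def triple_def by force

lemma step_mono:
  assumes "step Q D p x y" "D \<subseteq> D'" "\<And>x y. Q x y \<Longrightarrow> Q' x y"
  shows "step Q' D' p x y"
  using assms(1) unfolding step_def
  by (elim disj_forward conj_forward ex_forward all_forward imp_forward)
     (auto dest: assms(3) subsetD[OF assms(2)])

lemma justified_mono:
  assumes "justified Q D" "\<And>x y. Q x y \<Longrightarrow> Q' x y"
  shows "justified Q' D"
  using assms step_mono[of Q D _ _ _ D Q'] unfolding justified_def by blast

lemma justified_Union:
  assumes "\<And>D. D \<in> \<D> \<Longrightarrow> justified Q D"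
  shows "justified Q (\<Union>\<D>)"
  using assms step_mono[of Q _ _ _ _ "\<Union>\<D>" Q] unfolding justified_def by (meson Union_iff Sup_upper)

lemma justified_insert:
  assumes "justified Q D" "step Q D p x y"
  shows "justified Q (insert (triple p x y) D)"
  using assms step_mono[of Q D _ _ _ "insert (triple p x y) D" Q] unfolding justified_def
  by (auto simp: triple_def)

text \<open>Induction on the program. Since \<open>Q\<close> only has to imply the true answer,
  partial information about the oracle is enough.\<close>

lemma justified_sound:
  assumes "justified Q D" and Q: "\<And>x y. Q x y \<Longrightarrow> y = orc x"
  shows "triple (rf_code p) x y \<in> D \<Longrightarrow> ev orc p x y"
proof (induction p arbitrary: x y)
  case (Cn f g)
  then obtain w where "triple (rf_code g) x w \<in> D" "triple (rf_code f) w y \<in> D"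
    using justifiedD[OF assms(1) Cn.prems] by (auto simp: step_def)
  with Cn.IH show ?case by (blast intro: ev_Cn)
next
  case (Pr f g)
  then have "triple (rf_code f) x (pfst y) \<in> D" "triple (rf_code g) x (psnd y) \<in> D"
    using justifiedD[OF assms(1) Pr.prems] by (auto simp: step_def)
  with Pr.IH have "ev orc (Pr f g) x (prod_encode (pfst y, psnd y))" by (blast intro: ev_Pr)
  then show ?case by (simp add: pair_def[symmetric])
next
  case (Rc f g)
  \<comment> \<open>Recursion refers back to the same program, so an inner induction on the
    recursion argument is needed.\<close>
  have "triple (rf_code (Rc f g)) (pair a n) y \<in> D \<Longrightarrow> ev orc (Rc f g) (prod_encode (a, n)) y" for a n y
  proof (induction n arbitrary: y)
    case 0
    then have "triple (rf_code f) a y \<in> D"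
      using justifiedD[OF assms(1) 0] by (auto simp: step_def)
    with Rc.IH show ?case by (blast intro: ev_Rc0)
  next
    case (Suc n)
    then obtain w where "triple (rf_code (Rc f g)) (pair a n) w \<in> D"
        "triple (rf_code g) (pair a (pair n w)) y \<in> D"
      using justifiedD[OF assms(1) Suc.prems] by (auto simp: step_def)
    with Rc.IH Suc.IH show ?case unfolding pair_def by (blast intro: ev_RcS)
  qed
  from this[of "pfst x" "psnd x" y] Rc.prems show ?case
    by (simp add: pair_def[symmetric])
next
  case (Mn f)
  then have "triple (rf_code f) (pair x y) 0 \<in> D"
    "\<forall>m<y. \<exists>k. 0 < k \<and> triple (rf_code f) (pair x m) k \<in> D"
    using justifiedD[OF assms(1) Mn.prems] by (auto simp: step_def)
  with Mn.IH show ?case unfolding pair_def by (blast intro: ev_Mn)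
qed (drule justifiedD[OF assms(1)],
    auto simp: step_def ev_Zr ev_Sc ev_Idf ev_Fs[folded pfst_def] ev_Sn[folded psnd_def] ev_Orc dest: Q)+

definition derivable :: "(nat \<Rightarrow> nat) \<Rightarrow> nat \<Rightarrow> bool" where
  "derivable orc t \<longleftrightarrow> (\<exists>D. finite D \<and> justified (\<lambda>x y. y = orc x) D \<and> t \<in> D)"

text \<open>Justified sets are closed under unions, so the witnesses for the finitely many premises
  merge into one finite set, to which the conclusion is added.\<close>

lemma derivable_closed:
  assumes "finite T" "\<And>t. t \<in> T \<Longrightarrow> derivable orc t" "step (\<lambda>x y. y = orc x) T p x y"
  shows "derivable orc (triple p x y)"
proof -
  obtain f where f: "\<And>t. t \<in> T \<Longrightarrow> finite (f t) \<and> justified (\<lambda>x y. y = orc x) (f t) \<and> t \<in> f t"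
    using assms(2) unfolding derivable_def by metis
  let ?D = "\<Union> (f ` T)"
  have "finite ?D" "T \<subseteq> ?D" "justified (\<lambda>x y. y = orc x) ?D"
    using assms(1) f by (auto intro!: justified_Union)
  then have "step (\<lambda>x y. y = orc x) ?D p x y"
    by (intro step_mono[OF assms(3)])
  with \<open>justified _ ?D\<close> have "justified (\<lambda>x y. y = orc x) (insert (triple p x y) ?D)"
    by (rule justified_insert)
  moreover have "finite (insert (triple p x y) ?D)"
    using \<open>finite ?D\<close> by simp
  ultimately show ?thesis unfolding derivable_def by blast
qed

lemma ev_derivable: "ev orc p x y \<Longrightarrow> derivable orc (triple (rf_code p) x y)"
proof (induction rule: ev.induct)
  case (ev_Cn g x y f z)
  then show ?case
    by (intro derivable_closed[of "{triple (rf_code g) x y, triple (rf_code f) y z}"])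
       (auto simp: step_def)
next
  case (ev_Pr f x y g z)
  then show ?case
    by (intro derivable_closed[of "{triple (rf_code f) x y, triple (rf_code g) x z}"])
       (auto simp: step_def pair_def[symmetric])
next
  case (ev_Rc0 f x y g)
  then show ?case
    by (intro derivable_closed[of "{triple (rf_code f) x y}"])
       (auto simp: step_def pair_def[symmetric])
next
  case (ev_RcS f g x n y z)
  then show ?case
    by (intro derivable_closed[of "{triple (rf_code (Rc f g)) (pair x n) y, triple (rf_code g) (pair x (pair n y)) z}"])
       (auto simp: step_def pair_def[symmetric])
next
  case (ev_Mn f x n)
  then obtain k where k: "\<And>m. m < n \<Longrightarrow> 0 < k m \<and> derivable orc (triple (rf_code f) (pair x m) (k m))"
    unfolding pair_def by metis
  let ?T = "insert (triple (rf_code f) (pair x n) 0) ((\<lambda>m. triple (rf_code f) (pair x m) (k m)) ` {..<n})"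
  show ?case
  proof (rule derivable_closed)
    show "finite ?T" by simp
    show "derivable orc t" if "t \<in> ?T" for t
      using that k ev_Mn(1,2) by (auto simp: pair_def)
    show "step (\<lambda>x y. y = orc x) ?T (rf_code (Mn f)) x n"
      using k by (auto simp: step_def)
  qed
qed (rule derivable_closed[of "{}"]; simp add: step_def pfst_def psnd_def pair_def)+

text \<open>The use principle: every query of the finite computation is a component of one of its
  triples, hence smaller than \<open>u0\<close>.\<close>

lemma justified_complete:
  assumes "ev orc p x y"
  obtains d u0 where "triple (rf_code p) x y \<in> set_decode d"
    "\<And>u. u0 \<le> u \<Longrightarrow> justified (\<lambda>q y. q < u \<and> y = orc q) (set_decode d)"
proof -
  obtain D where D: "finite D" "justified (\<lambda>x y. y = orc x) D" "triple (rf_code p) x y \<in> D"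
    using ev_derivable[OF assms] unfolding derivable_def by blast
  define u0 where "u0 = Suc (Max D)"
  have "justified (\<lambda>q y. q < u \<and> y = orc q) D" if "u0 \<le> u" for u
    unfolding justified_def
  proof
    fix t assume t: "t \<in> D"
    have "t < u0" using t D(1) by (simp add: u0_def le_imp_less_Suc)
    moreover have "pfst (psnd t) \<le> t"
      using le_triple(2)[of "pfst (psnd t)" "pfst t" "psnd (psnd t)"] by (simp add: triple_def)
    ultimately have "pfst (psnd t) < u" using that by linarith
    with D(2) t show "step (\<lambda>q y. q < u \<and> y = orc q) D (pfst t) (pfst (psnd t)) (psnd (psnd t))"
      unfolding justified_def by (auto simp: step_def)
  qed
  with D show ?thesis
    by (intro that[of "set_encode D" u0]) (simp_all add: set_encode_inverse)
qed

section \<open>Decidability of being a coded computation\<close>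

lemma dec_in_mem_triple:
  assumes "comp_in orc p" "comp_in orc x" "comp_in orc y" "comp_in orc d"
  shows "dec_in orc (\<lambda>e. triple (p e) (x e) (y e) \<in> set_decode (d e))"
  unfolding triple_def by (intro comp_intros assms)

lemma mem_triple_less:
  "triple p x y \<in> set_decode d \<Longrightarrow> p < d \<and> x < d \<and> y < d"
  using mem_set_decode_less le_triple le_less_trans by blast

text \<open>The components of a triple in \<open>set_decode d\<close> are smaller than
  \<open>d\<close>, so every quantifier in \<open>step\<close> may be bounded by \<open>d\<close>.
  This turns the condition into a decidable one.\<close>

lemma justified_set_decode:
  "justified Q (set_decode d) \<longleftrightarrow> (\<forall>t<d. t \<in> set_decode d \<longrightarrow> (let p = pfst t; x = pfst (psnd t); y = psnd (psnd t) in
     pfst p = 0 \<and> y = 0 \<or>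
     pfst p = 1 \<and> y = Suc x \<or>
     pfst p = 2 \<and> y = x \<or>
     pfst p = 3 \<and> y = pfst x \<or>
     pfst p = 4 \<and> y = psnd x \<or>
     pfst p = 5 \<and> Q x y \<or>
     pfst p = 6 \<and> (\<exists>w<d. triple (psnd (psnd p)) x w \<in> set_decode d \<and> triple (pfst (psnd p)) w y \<in> set_decode d) \<or>
     pfst p = 7 \<and> triple (pfst (psnd p)) x (pfst y) \<in> set_decode d \<and> triple (psnd (psnd p)) x (psnd y) \<in> set_decode d \<or>
     pfst p = 8 \<and> psnd x = 0 \<and> triple (pfst (psnd p)) (pfst x) y \<in> set_decode d \<or>
     pfst p = 8 \<and> 0 < psnd x \<and>
       (\<exists>w<d. triple p (pair (pfst x) (psnd x - 1)) w \<in> set_decode d \<and>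
            triple (psnd (psnd p)) (pair (pfst x) (pair (psnd x - 1) w)) y \<in> set_decode d) \<or>
     pfst p = 9 \<and> triple (psnd p) (pair x y) 0 \<in> set_decode d \<and>
       (\<forall>m<y. \<exists>k<d. 0 < k \<and> triple (psnd p) (pair x m) k \<in> set_decode d)))"
proof -
  have *: "(\<exists>w. triple a b w \<in> set_decode d \<and> R w) \<longleftrightarrow> (\<exists>w<d. triple a b w \<in> set_decode d \<and> R w)"
      "(\<exists>w. 0 < w \<and> triple a b w \<in> set_decode d) \<longleftrightarrow> (\<exists>w<d. 0 < w \<and> triple a b w \<in> set_decode d)" for a b R
    using mem_triple_less by blast+
  have all: "(\<forall>t\<in>set_decode d. S t) \<longleftrightarrow> (\<forall>t<d. t \<in> set_decode d \<longrightarrow> S t)" for S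
    using mem_set_decode_less by blast
  show ?thesis
    unfolding justified_def step_def Let_def * all ..
qed

text \<open>This plays the role of Kleene's T predicate. The permitted answers \<open>Q e\<close>
  may vary with the input \<open>e\<close>, as happens when the oracle is itself built from coded
  data.\<close>

lemma dec_in_justified:
  assumes d: "comp_in orc d"
    and Q: "dec_in orc (\<lambda>w. Q (pfst w) (pfst (psnd w)) (psnd (psnd w)))"
  shows "dec_in orc (\<lambda>e. justified (Q e) (set_decode (d e)))"
proof -
  have d': "comp_in orc (\<lambda>w. d (f w))" if "comp_in orc f" for f
    using comp_in_compose[OF d that] .
  have Q': "dec_in orc (\<lambda>w. Q (f w) (g w) (h w))"
    if "comp_in orc f" "comp_in orc g" "comp_in orc h" for f g h
    using dec_in_compose[OF Q, of "\<lambda>w. pair (f w) (pair (g w) (h w))"] that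
    by (simp add: comp_in_pair)
  show ?thesis
    unfolding justified_set_decode Let_def
    by (intro dec_in_mem_triple Q' d' comp_intros)
qed

lemma comp_in_compose2:
  assumes "comp_in orc (\<lambda>w. F (pfst w) (psnd w))" "comp_in orc f" "comp_in orc g"
  shows "comp_in orc (\<lambda>x. F (f x) (g x))"
  using comp_in_compose[OF assms(1) comp_in_pair[OF assms(2,3)]] by simp

lemma dec_in_compose2:
  assumes "dec_in orc (\<lambda>w. F (pfst w) (psnd w))" "comp_in orc f" "comp_in orc g"
  shows "dec_in orc (\<lambda>x. F (f x) (g x))"
  using dec_in_compose[OF assms(1) comp_in_pair[OF assms(2,3)]] by simp

lemma dec_in_compose3:
  assumes "dec_in orc (\<lambda>w. F (pfst w) (pfst (psnd w)) (psnd (psnd w)))"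
    "comp_in orc f" "comp_in orc g" "comp_in orc h"
  shows "dec_in orc (\<lambda>x. F (f x) (g x) (h x))"
  using dec_in_compose[OF assms(1) comp_in_pair[OF assms(2) comp_in_pair[OF assms(3,4)]]] by simp

section \<open>The prefix relation on string codes\<close>

lemma scode_append: "scode (s @ t) = scode s + 2 ^ length s * scode t"
  by (induction s) (auto simp: algebra_simps)

text \<open>The length of a string can be read off its code: it is the integer part of the binary
  logarithm of \<open>Suc (scode s)\<close>.\<close>

lemma scode_bounds: "2 ^ length s \<le> Suc (scode s)" "Suc (scode s) < 2 * 2 ^ length s"
  by (induction s) auto

lemma length_le_scode: "length s \<le> scode s"
  using scode_bounds(1)[of s] less_exp[of "length s"] by linarith

lemma inj_scode: "inj scode"
proof (rule injI)
  show "scode s = scode t \<Longrightarrow> s = t" for s t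
  proof (induction s arbitrary: t)
    case Nil
    then show ?case by (cases t) (auto split: if_splits)
  next
    case (Cons b s)
    then obtain c t' where t: "t = c # t'" by (cases t) (auto split: if_splits)
    with Cons.prems have "b = c \<and> scode s = scode t'"
      by (auto split: if_splits) presburger+
    with Cons.IH t show ?case by simp
  qed
qed

lemma surj_scode: "surj scode"
proof -
  have "\<exists>s. n = scode s" for n
  proof (induction n rule: less_induct)
    case (less n)
    show ?case
    proof (cases "n = 0")
      case True
      then show ?thesis by (metis scode.simps(1))
    next
      case False
      \<comment> \<open>The leading digit of a positive code is 2 (for \<open>True\<close>) exactly
        when the code is even.\<close>
      define b where "b = even n"
      define k where "k = (n - (if b then 2 else 1)) div 2"
      have n: "n = 2 * k + (if b then 2 else 1)"
        using False unfolding k_def b_def by (auto elim!: evenE oddE)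
      then obtain s where "k = scode s"
        using less.IH[of k] by (auto split: if_splits)
      with n have "n = scode (b # s)" by simp
      then show ?thesis by blast
    qed
  qed
  then show ?thesis by (auto simp: surj_def)
qed

text \<open>Here \<open>m\<close> is the length of the string with code \<open>t\<close>, and
  \<open>r\<close> is the code of the string appended to it. Both are bounded by \<open>x\<close>,
  which makes the relation decidable.\<close>

definition code_prefix :: "nat \<Rightarrow> nat \<Rightarrow> bool" where
  "code_prefix t x \<longleftrightarrow>
     (\<exists>m<Suc x. \<exists>r<Suc x. 2 ^ m \<le> Suc t \<and> Suc t < 2 * 2 ^ m \<and> x = t + 2 ^ m * r)"

lemma code_prefix_scode [simp]: "code_prefix (scode s) (scode t) \<longleftrightarrow> prefix s t"
proof
  assume "prefix s t"
  then obtain r where t: "t = s @ r" by (auto elim: prefixE)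
  then have "length s \<le> scode t"
    using length_le_scode[of t] by simp
  moreover have "scode r \<le> scode t"
    using t by (simp add: scode_append trans_le_add2)
  ultimately show "code_prefix (scode s) (scode t)"
    unfolding code_prefix_def using scode_bounds[of s] t scode_append[of s r]
    by (intro exI[of _ "length s"] exI[of _ "scode r"] conjI) auto
next
  assume "code_prefix (scode s) (scode t)"
  then obtain m r where m: "2 ^ m \<le> Suc (scode s)" "Suc (scode s) < 2 ^ Suc m"
      and t: "scode t = scode s + 2 ^ m * r"
    unfolding code_prefix_def by auto
  have "(2::nat) ^ m < 2 ^ Suc (length s)" "(2::nat) ^ length s < 2 ^ Suc m"
    using m scode_bounds[of s] by simp_all
  then have "m = length s"
    using power_less_imp_less_exp[of "2::nat"] by (metis Suc_1 lessI less_Suc_eq_le order.antisym)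
  moreover obtain r' where "r = scode r'" using surj_scode by (metis surjD)
  ultimately have "scode t = scode (s @ r')" using t by (simp add: scode_append)
  then show "prefix s t" using inj_scode by (metis injD prefixI)
qed

lemma dec_in_code_prefix:
  "comp_in orc f \<Longrightarrow> comp_in orc g \<Longrightarrow> dec_in orc (\<lambda>x. code_prefix (f x) (g x))"
proof (rule dec_in_compose2)
  show "dec_in orc (\<lambda>w. code_prefix (pfst w) (psnd w))"
    unfolding code_prefix_def by (intro comp_intros)
qed

lemma code_prefix_le: "code_prefix t x \<Longrightarrow> t \<le> x"
  unfolding code_prefix_def by auto

section \<open>A limit computable set that follows every clopen set on long intervals\<close>

abbreviation zero :: "nat \<Rightarrow> nat" where
  "zero \<equiv> \<lambda>_. 0"

lemma chi_empty: "chi {} = zero"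
  by (auto simp: chi_def)

text \<open>The bound \<open>s\<close> also applies to the output \<open>y\<close>, so a stage at
  which a program is seen to halt exceeds its value.\<close>

definition halts_by :: "nat \<Rightarrow> nat \<Rightarrow> nat \<Rightarrow> bool" where
  "halts_by s e x \<longleftrightarrow>
     (\<exists>d<s. justified (\<lambda>_ y. y = 0) (set_decode d) \<and> (\<exists>y<s. triple e x y \<in> set_decode d))"

text \<open>A computable guess at \<open>final_stage n\<close> that takes into account only the
  computations found by stage \<open>s\<close>.\<close>

definition stage :: "nat \<Rightarrow> nat \<Rightarrow> nat" where
  "stage s n = (LEAST w. \<forall>e<Suc n. \<forall>x<Suc n. halts_by s e x \<longrightarrow> halts_by w e x)"

text \<open>A busy beaver function: it exceeds every value of a program with code at most
  \<open>n\<close> at an argument at most \<open>n\<close>.\<close>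

definition final_stage :: "nat \<Rightarrow> nat" where
  "final_stage n = (LEAST w. \<forall>e<Suc n. \<forall>x<Suc n. \<forall>s. halts_by s e x \<longrightarrow> halts_by w e x)"

lemma halts_by_mono: "halts_by s e x \<Longrightarrow> s \<le> s' \<Longrightarrow> halts_by s' e x"
  unfolding halts_by_def by (meson less_le_trans)

lemma final_stage:
  assumes "e \<le> n" "x \<le> n" "halts_by s e x"
  shows "halts_by (final_stage n) e x"
proof -
  \<comment> \<open>For a pair that never halts this is an unspecified number, which can only
    enlarge the maximum.\<close>
  let ?l = "\<lambda>p. LEAST s. halts_by s (fst p) (snd p)"
  let ?W = "Max (?l ` ({..n} \<times> {..n}))"
  have "halts_by ?W e x" if "e \<le> n" "x \<le> n" "halts_by s e x" for e x s
  proof -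
    have "?l (e, x) \<le> ?W" using that by (intro Max_ge imageI) auto
    moreover have "halts_by (?l (e, x)) e x" using LeastI[of "\<lambda>s. halts_by s e x"] that(3) by simp
    ultimately show ?thesis using halts_by_mono by blast
  qed
  then have "\<forall>e<Suc n. \<forall>x<Suc n. \<forall>s. halts_by s e x \<longrightarrow> halts_by ?W e x"
    by (auto simp: less_Suc_eq_le)
  from LeastI[of "\<lambda>w. \<forall>e<Suc n. \<forall>x<Suc n. \<forall>s. halts_by s e x \<longrightarrow> halts_by w e x", OF this]
  show ?thesis using assms unfolding final_stage_def by (auto simp: less_Suc_eq_le)
qed

lemma stage_eq_final_stage:
  assumes "final_stage n \<le> s"
  shows "stage s n = final_stage n"
proof -
  have "(\<forall>e<Suc n. \<forall>x<Suc n. halts_by s e x \<longrightarrow> halts_by w e x) \<longleftrightarrow>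
        (\<forall>e<Suc n. \<forall>x<Suc n. \<forall>s. halts_by s e x \<longrightarrow> halts_by w e x)" for w
    using final_stage halts_by_mono[OF _ assms] by (meson less_Suc_eq_le)
  then show ?thesis unfolding stage_def final_stage_def by simp
qed

definition threshold_at :: "nat \<Rightarrow> nat \<Rightarrow> nat" where
  "threshold_at s n = rec_nat 0 (\<lambda>_ y. Suc (y + stage s y)) n"

text \<open>The sequence \<open>h\<close> of the opening idea; \<open>threshold_at s\<close> is its
  approximation at stage \<open>s\<close>. The \<open>Suc\<close> makes it strictly
  increasing.\<close>

definition threshold :: "nat \<Rightarrow> nat" where
  "threshold n = rec_nat 0 (\<lambda>_ y. Suc (y + final_stage y)) n"

lemma threshold_at_Suc: "threshold_at s (Suc n) = Suc (threshold_at s n + stage s (threshold_at s n))"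
  and threshold_Suc: "threshold (Suc n) = Suc (threshold n + final_stage (threshold n))"
  by (simp_all add: threshold_at_def threshold_def)

lemma le_threshold_at: "n \<le> threshold_at s n"
  by (induction n) (simp_all add: threshold_at_Suc)

lemma strict_mono_threshold: "strict_mono threshold"
  by (simp add: strict_mono_Suc_iff threshold_Suc)

lemma threshold_at_eq: "threshold n \<le> s \<Longrightarrow> threshold_at s n = threshold n"
proof (induction n)
  case 0
  then show ?case by (simp add: threshold_at_def threshold_def)
next
  case (Suc n)
  then show ?case by (simp add: threshold_Suc threshold_at_Suc stage_eq_final_stage)
qed

text \<open>The number \<open>k\<close> codes a finite set of strings, and this is the clopen set
  generated by it. A prefix has the smaller code, so bounding \<open>t\<close> loses
  nothing.\<close>

definition follows :: "nat \<Rightarrow> nat \<Rightarrow> bool" where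
  "follows k x \<longleftrightarrow> (\<exists>t<Suc x. t \<in> set_decode k \<and> code_prefix t x)"

lemma follows_iff: "follows k x \<longleftrightarrow> (\<exists>t\<in>set_decode k. code_prefix t x)"
  unfolding follows_def using code_prefix_le by (auto simp: less_Suc_eq_le)

definition follower_at :: "nat \<Rightarrow> nat \<Rightarrow> bool" where
  "follower_at s x \<longleftrightarrow> follows (pfst (LEAST n. x \<le> threshold_at s (Suc n))) x"

text \<open>For positive \<open>x\<close>, the least \<open>n\<close> is the index of the interval
  between consecutive thresholds that contains \<open>x\<close>; code 0 joins the first interval.
  The second component of \<open>n\<close> is padding, by which one clopen set is copied on
  infinitely many intervals.\<close>

definition follower :: "nat set" where
  "follower = {x. follows (pfst (LEAST n. x \<le> threshold (Suc n))) x}"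

lemma dec_in_follower_at: "dec_in orc (\<lambda>w. follower_at (pfst w) (psnd w))"
proof -
  have h: "dec_in orc (\<lambda>x. halts_by (f x) (g x) (h x))"
    if "comp_in orc f" "comp_in orc g" "comp_in orc h" for f g h
  proof (rule dec_in_compose3[OF _ that])
    show "dec_in orc (\<lambda>w. halts_by (pfst w) (pfst (psnd w)) (psnd (psnd w)))"
      unfolding halts_by_def by (intro dec_in_justified dec_in_mem_triple comp_intros)
  qed
  have s: "comp_in orc (\<lambda>x. stage (f x) (g x))"
    if "comp_in orc f" "comp_in orc g" for f g
  proof (rule comp_in_compose2[OF _ that])
    show "comp_in orc (\<lambda>w. stage (pfst w) (psnd w))"
      unfolding stage_def by (intro comp_in_Least) (intro h comp_intros, blast)
  qed
  have t: "comp_in orc (\<lambda>x. threshold_at (f x) (g x))"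
    if "comp_in orc f" "comp_in orc g" for f g
  proof (rule comp_in_compose2[OF _ that])
    show "comp_in orc (\<lambda>w. threshold_at (pfst w) (psnd w))"
      unfolding threshold_at_def by (intro comp_in_rec s comp_intros)
  qed
  have l: "comp_in orc (\<lambda>w. LEAST n. psnd w \<le> threshold_at (pfst w) (Suc n))"
  proof (intro comp_in_Least)
    show "dec_in orc (\<lambda>w. psnd (pfst w) \<le> threshold_at (pfst (pfst w)) (Suc (psnd w)))"
      by (intro t comp_intros)
    show "\<exists>n. psnd w \<le> threshold_at (pfst w) (Suc n)" for w
      using le_threshold_at[of "Suc (psnd w)"] by (meson Suc_leD)
  qed
  show ?thesis
    unfolding follower_at_def follows_def
    by (intro dec_in_code_prefix comp_intros comp_in_compose[OF l])
qed

lemma follower_at_limit: "\<exists>s0. \<forall>s\<ge>s0. follower_at s x \<longleftrightarrow> x \<in> follower"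
proof -
  define n where "n = (LEAST n. x \<le> threshold (Suc n))"
  have "\<exists>n. x \<le> threshold (Suc n)"
    using strict_mono_imp_increasing[OF strict_mono_threshold, of "Suc x"] Suc_leD by blast
  then have n: "x \<le> threshold (Suc n)" unfolding n_def by (rule LeastI_ex)
  \<comment> \<open>From this stage on, the guessed thresholds are correct up to index
    \<open>Suc n\<close>, so the interval containing \<open>x\<close> is identified
    correctly.\<close>
  have "(LEAST n. x \<le> threshold_at s (Suc n)) = n" if s: "threshold (Suc n) \<le> s" for s
  proof (rule Least_equality)
    show "x \<le> threshold_at s (Suc n)" using n s by (simp add: threshold_at_eq)
    show "n \<le> m" if "x \<le> threshold_at s (Suc m)" for m
    proof (rule ccontr)
      assume "\<not> n \<le> m"
      then have "threshold (Suc m) \<le> threshold (Suc n)"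
        using strict_mono_less_eq[OF strict_mono_threshold] by simp
      with s that have "x \<le> threshold (Suc m)" by (simp add: threshold_at_eq)
      then have "n \<le> m" unfolding n_def by (rule Least_le)
      with \<open>\<not> n \<le> m\<close> show False by simp
    qed
  qed
  then show ?thesis
    unfolding follower_at_def follower_def mem_Collect_eq n_def[symmetric] by auto
qed

text \<open>The easy direction of the limit lemma: membership means that the guess is positive at
  all stages from some \<open>y\<close> on.\<close>

lemma Sigma2_limit:
  assumes "dec_in zero (\<lambda>w. G (pfst w) (psnd w))"
    and "\<And>x. \<exists>s0. \<forall>s\<ge>s0. G s x \<longleftrightarrow> x \<in> A"
  shows "Sigma2 A"
proof -
  let ?P = "\<lambda>w. pfst (psnd w) \<le> psnd (psnd w) \<longrightarrow> G (psnd (psnd w)) (pfst w)"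
  have "dec_in zero ?P"
    by (intro dec_in_compose2[OF assms(1)] comp_intros)
  moreover have "chi (Collect ?P) x = of_bool (?P x)" for x
    by (simp add: chi_def)
  ultimately have "computable (Collect ?P)"
    unfolding computable_def turing_le_def dec_in_def comp_in_def chi_empty by simp
  moreover have "x \<in> A \<longleftrightarrow> (\<exists>y. \<forall>z. prod_encode (x, prod_encode (y, z)) \<in> Collect ?P)" for x
    using assms(2)[of x] by (simp add: pair_def[symmetric]) (meson nat_le_linear)
  ultimately show ?thesis unfolding Sigma2_def by blast
qed

lemma Delta2_follower: "Delta2 follower" and Delta2_Compl_follower: "Delta2 (- follower)"
proof -
  have "Sigma2 follower"
    by (rule Sigma2_limit[OF dec_in_follower_at follower_at_limit])
  moreover have "Sigma2 (- follower)"
    by (rule Sigma2_limit[OF dec_in_not[OF dec_in_follower_at]]) (use follower_at_limit in simp)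
  ultimately show "Delta2 follower" "Delta2 (- follower)"
    unfolding Delta2_def by simp_all
qed

text \<open>Let \<open>n\<close> code both \<open>V\<close> and a program \<open>p\<close> for
  \<open>f\<close>, and let \<open>l = threshold n\<close>. Then
  \<open>rf_code p \<le> n \<le> l\<close>, so \<open>final_stage l\<close> exceeds
  \<open>f l\<close>. Hence \<open>f l\<close> comes before the end of the interval starting at
  \<open>l\<close>, on which the clopen set of \<open>V\<close> is copied.\<close>

lemma follower_fair:
  assumes "comp_in zero f" "finite V"
  shows "\<exists>l. \<forall>x. l < x \<and> x \<le> f l \<longrightarrow> (x \<in> follower \<longleftrightarrow> (\<exists>t\<in>V. code_prefix t x))"
proof -
  obtain p where p: "\<And>x. ev zero p x (f x)"
    using assms(1) unfolding comp_in_def by blast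
  define n where "n = pair (set_encode V) (rf_code p)"
  define l where "l = threshold n"
  have "rf_code p \<le> l"
    using strict_mono_imp_increasing[OF strict_mono_threshold, of n] le_pair2[of "rf_code p"]
    unfolding l_def n_def by (meson le_trans)
  obtain d u0 where "triple (rf_code p) l (f l) \<in> set_decode d"
    "\<And>u. u0 \<le> u \<Longrightarrow> justified (\<lambda>q y. q < u \<and> y = 0) (set_decode d)"
    using justified_complete[OF p[of l]] by metis
  moreover from this(2)[OF le_refl] have "justified (\<lambda>_ y. y = 0) (set_decode d)"
    by (rule justified_mono) simp
  ultimately have "halts_by (Suc (max d (f l))) (rf_code p) l"
    unfolding halts_by_def by (intro exI[of _ d] exI[of _ "f l"] conjI) simp_all
  then have "halts_by (final_stage l) (rf_code p) l"
    using final_stage \<open>rf_code p \<le> l\<close> by blast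
  then obtain d' y where d': "justified (\<lambda>_ y. y = 0) (set_decode d')"
      "triple (rf_code p) l y \<in> set_decode d'" and y: "y < final_stage l"
    unfolding halts_by_def by blast
  have "ev zero p l y"
    by (rule justified_sound[OF d'(1) _ d'(2)])
  then have "f l < threshold (Suc n)"
    using ev_deterministic p y by (metis l_def less_SucI threshold_Suc trans_less_add2)
  moreover have "(LEAST m. x \<le> threshold (Suc m)) = n" if "l < x" "x \<le> threshold (Suc n)" for x
  proof (rule Least_equality)
    show "n \<le> m" if m: "x \<le> threshold (Suc m)" for m
    proof -
      have "threshold n < threshold (Suc m)" using m \<open>l < x\<close> by (simp add: l_def)
      then show ?thesis using strict_mono_less[OF strict_mono_threshold] by simp
    qed
  qed (rule that(2))
  ultimately show ?thesis
    using assms(2) by (intro exI[of _ l]) (auto simp: follower_def follows_iff n_def set_encode_inverse)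
qed

section \<open>Compactness of Cantor space\<close>

text \<open>Koenig's lemma: if no single \<open>U\<close> were enough, a path of initial segments
  with bad extensions for every \<open>U\<close> would define an uncovered set.\<close>

lemma cantor_compact:
  fixes R :: "nat \<Rightarrow> nat set \<Rightarrow> bool"
  assumes local: "\<And>u Z Z'. Z \<inter> {..<u} = Z' \<inter> {..<u} \<Longrightarrow> R u Z = R u Z'"
    and mono: "\<And>u v Z. R u Z \<Longrightarrow> u \<le> v \<Longrightarrow> R v Z"
    and cover: "\<And>Z. \<exists>u. R u Z"
  shows "\<exists>U. \<forall>Z. R U Z"
proof (rule ccontr)
  assume no: "\<nexists>U. \<forall>Z. R U Z"
  \<comment> \<open>The bad extension \<open>Z\<close> may depend on \<open>U\<close>; by
    monotonicity one of the two one-bit extensions of a good segment is again good.\<close>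
  define good where "good n s \<longleftrightarrow> s \<subseteq> {..<n} \<and> (\<forall>U. \<exists>Z. Z \<inter> {..<n} = s \<and> \<not> R U Z)" for n s
  have 0: "\<exists>s. good 0 s"
    using no by (auto simp: good_def)
  have step: "\<exists>s'. good (Suc n) s' \<and> s = s' \<inter> {..<n}" if s: "good n s" for n s
  proof (rule ccontr)
    assume "\<not> ?thesis"
    moreover have "s \<inter> {..<n} = s" "insert n s \<inter> {..<n} = s" "s \<subseteq> {..<Suc n}" "insert n s \<subseteq> {..<Suc n}"
      using s by (auto simp: good_def)
    ultimately obtain U1 U2 where
      U1: "\<And>Z. Z \<inter> {..<Suc n} = s \<Longrightarrow> R U1 Z" and
      U2: "\<And>Z. Z \<inter> {..<Suc n} = insert n s \<Longrightarrow> R U2 Z"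
      unfolding good_def by metis
    obtain Z where Z: "Z \<inter> {..<n} = s" "\<not> R (max U1 U2) Z"
      using s unfolding good_def by blast
    have "Z \<inter> {..<Suc n} = (if n \<in> Z then insert n s else s)"
      using Z(1) by (auto simp: less_Suc_eq)
    then have "R U1 Z \<or> R U2 Z" using U1 U2 by metis
    then show False using mono Z(2) by (meson max.cobounded1 max.cobounded2)
  qed
  obtain s where s: "\<And>n. good n (s n)" "\<And>n. s n = s (Suc n) \<inter> {..<n}"
    using dependent_nat_choice[of good "\<lambda>n s s'. s = s' \<inter> {..<n}", OF 0 step] by blast
  have restr: "s (n + k) \<inter> {..<n} = s n" for n k
  proof (induction k)
    case 0
    then show ?case using s(1)[of n] by (auto simp: good_def)
  next
    case (Suc k)
    have "s (n + k) \<inter> {..<n} = s (Suc (n + k)) \<inter> ({..<n + k} \<inter> {..<n})"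
      by (subst s(2)[of "n + k"]) (rule Int_assoc)
    also have "{..<n + k} \<inter> {..<n} = {..<n}" by auto
    finally show ?case using Suc.IH by simp
  qed
  let ?Z = "\<Union>n. s n"
  have Z: "?Z \<inter> {..<n} = s n" for n
  proof (intro equalityI subsetI)
    fix i assume "i \<in> ?Z \<inter> {..<n}"
    then obtain m where "i \<in> s m" "i < n" by blast
    then show "i \<in> s n"
      using restr[of n "m - n"] restr[of m "n - m"] by (cases "n \<le> m") auto
  next
    fix i assume "i \<in> s n"
    moreover have "s n \<subseteq> {..<n}" using s(1) by (simp add: good_def)
    ultimately show "i \<in> ?Z \<inter> {..<n}" by blast
  qed
  \<comment> \<open>\<open>R u\<close> sees only the bits below \<open>u\<close>, and these the path
    shares with a set that is bad at \<open>u\<close>.\<close>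
  obtain u where "R u ?Z" using cover by blast
  moreover obtain Z' where "Z' \<inter> {..<u} = s u" "\<not> R u Z'"
    using s(1)[of u] unfolding good_def by blast
  ultimately show False using local[of Z' u ?Z] Z by simp
qed

text \<open>If the classes had no common member, the condition that \<open>R n u Z\<close> holds for
  some \<open>n \<le> u\<close> would be an open cover. Compactness gives one \<open>U\<close>, and
  nesting reduces it to \<open>R U U\<close>, so class \<open>U\<close> would be empty.\<close>

lemma nested_classes_meet:
  fixes R :: "nat \<Rightarrow> nat \<Rightarrow> nat set \<Rightarrow> bool"
  assumes local: "\<And>n u Z Z'. Z \<inter> {..<u} = Z' \<inter> {..<u} \<Longrightarrow> R n u Z = R n u Z'"
    and mono: "\<And>n u v Z. R n u Z \<Longrightarrow> u \<le> v \<Longrightarrow> R n v Z"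
    and nested: "\<And>n u Z. R n u Z \<Longrightarrow> R (Suc n) u Z"
    and nonempty: "\<And>n. \<exists>Z. \<forall>u. \<not> R n u Z"
  shows "\<exists>Z. \<forall>n u. \<not> R n u Z"
proof (rule ccontr)
  assume no: "\<nexists>Z. \<forall>n u. \<not> R n u Z"
  have nested': "R m u Z" if "n \<le> m" "R n u Z" for n m u Z
    using that by (induction m rule: dec_induct) (auto intro: nested)
  have "\<exists>U. \<forall>Z. \<exists>n\<le>U. R n U Z"
  proof (rule cantor_compact)
    show "(\<exists>n\<le>u. R n u Z) = (\<exists>n\<le>u. R n u Z')" if "Z \<inter> {..<u} = Z' \<inter> {..<u}" for u Z Z'
      using local[OF that] by simp
    show "\<exists>n\<le>v. R n v Z" if "\<exists>n\<le>u. R n u Z" "u \<le> v" for u v Z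
      using that mono by (meson le_trans)
    show "\<exists>u. \<exists>n\<le>u. R n u Z" for Z
      using no mono by (meson max.cobounded1 max.cobounded2)
  qed
  then obtain U where "\<forall>Z. R U U Z" using nested' by blast
  with nonempty show False by blast
qed

section \<open>Computably dominated oracles\<close>

definition tame :: "(nat \<Rightarrow> nat) \<Rightarrow> bool" where
  "tame orc \<longleftrightarrow> (\<forall>f. comp_in orc f \<longrightarrow> (\<exists>g. comp_in zero g \<and> (\<forall>x. f x \<le> g x)))"

lemma tame_zero: "tame zero"
  unfolding tame_def by blast

text \<open>Open sets indexed by \<open>x\<close> and enumerated uniformly in \<open>orc\<close>;
  \<open>u\<close> is both the stage and the number of bits of \<open>Z\<close> that are read. By
  locality it is enough to decide them on coded finite sets. The sets \<open>Z\<close> with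
  \<open>\<not> R x u Z\<close> for all \<open>u\<close> form a Pi-0-1 class relative to
  \<open>orc\<close>.\<close>

definition open_family :: "(nat \<Rightarrow> nat) \<Rightarrow> (nat \<Rightarrow> nat \<Rightarrow> nat set \<Rightarrow> bool) \<Rightarrow> bool" where
  "open_family orc R \<longleftrightarrow>
     dec_in orc (\<lambda>w. R (pfst w) (pfst (psnd w)) (set_decode (psnd (psnd w)))) \<and>
     (\<forall>x u Z Z'. Z \<inter> {..<u} = Z' \<inter> {..<u} \<longrightarrow> R x u Z = R x u Z') \<and>
     (\<forall>x u v Z. R x u Z \<longrightarrow> u \<le> v \<longrightarrow> R x v Z)"

lemma open_familyI:
  assumes "dec_in orc (\<lambda>w. R (pfst w) (pfst (psnd w)) (set_decode (psnd (psnd w))))"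
    and "\<And>x u Z Z'. Z \<inter> {..<u} = Z' \<inter> {..<u} \<Longrightarrow> R x u Z = R x u Z'"
    and "\<And>x u v Z. R x u Z \<Longrightarrow> u \<le> v \<Longrightarrow> R x v Z"
  shows "open_family orc R"
  unfolding open_family_def using assms by (intro conjI allI impI)

lemma
  assumes "open_family orc R"
  shows open_family_dec: "dec_in orc (\<lambda>w. R (pfst w) (pfst (psnd w)) (set_decode (psnd (psnd w))))"
    and open_family_local: "Z \<inter> {..<u} = Z' \<inter> {..<u} \<Longrightarrow> R x u Z = R x u Z'"
    and open_family_mono: "R x u Z \<Longrightarrow> u \<le> v \<Longrightarrow> R x v Z"
proof -
  from assms have *: "\<forall>x u Z Z'. Z \<inter> {..<u} = Z' \<inter> {..<u} \<longrightarrow> R x u Z = R x u Z'"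
    "\<forall>x u v Z. R x u Z \<longrightarrow> u \<le> v \<longrightarrow> R x v Z"
    unfolding open_family_def by (rule conjunct2[THEN conjunct1], rule conjunct2[THEN conjunct2])
  show "Z \<inter> {..<u} = Z' \<inter> {..<u} \<Longrightarrow> R x u Z = R x u Z'"
    by (rule *(1)[rule_format])
  show "R x u Z \<Longrightarrow> u \<le> v \<Longrightarrow> R x v Z"
    by (rule *(2)[rule_format])
  from assms show "dec_in orc (\<lambda>w. R (pfst w) (pfst (psnd w)) (set_decode (psnd (psnd w))))"
    unfolding open_family_def by (rule conjunct1)
qed

lemma open_family_disj:
  assumes R: "open_family orc R" and S: "open_family orc S"
  shows "open_family orc (\<lambda>x u Z. R x u Z \<or> S x u Z)"
proof (rule open_familyI)
  show "dec_in orc (\<lambda>w. R (pfst w) (pfst (psnd w)) (set_decode (psnd (psnd w))) \<or>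
      S (pfst w) (pfst (psnd w)) (set_decode (psnd (psnd w))))"
    by (intro dec_in_disj open_family_dec R S)
  show "(R x u Z \<or> S x u Z) = (R x u Z' \<or> S x u Z')" if "Z \<inter> {..<u} = Z' \<inter> {..<u}" for x u Z Z'
    using open_family_local[OF R that] open_family_local[OF S that] by simp
  show "R x v Z \<or> S x v Z" if "R x u Z \<or> S x u Z" "u \<le> v" for x u v Z
    using that(1) open_family_mono[OF R _ that(2)] open_family_mono[OF S _ that(2)] by blast
qed

lemma open_family_fix:
  assumes "open_family orc R"
  shows "open_family orc (\<lambda>_. R x)"
proof (rule open_familyI)
  show "dec_in orc (\<lambda>w. R x (pfst (psnd w)) (set_decode (psnd (psnd w))))"
    by (rule dec_in_compose3[of _ "\<lambda>x u z. R x u (set_decode z)", OF open_family_dec[OF assms]])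
       (intro comp_intros)+
qed (rule open_family_local[OF assms] open_family_mono[OF assms]; assumption)+

lemma set_encode_less: "A \<subseteq> {..<u} \<Longrightarrow> set_encode A < 2 ^ u"
proof -
  assume "A \<subseteq> {..<u}"
  then have "set_encode A \<le> (\<Sum>i<u. 2 ^ i)"
    unfolding set_encode_def by (intro sum_mono2) auto
  also have "\<dots> < 2 ^ u"
    by (induction u) auto
  finally show ?thesis .
qed

text \<open>By compactness each \<open>x\<close> has a uniform stage, and by locality a stage is
  tested on finitely many coded sets. So the least uniform stage is computable from
  \<open>orc\<close>, and tameness replaces it by a computable bound.\<close>

lemma open_family_bound:
  assumes R: "open_family orc R" and cover: "\<And>x Z. \<exists>u. R x u Z" and "tame orc"
  obtains g where "comp_in zero g" "\<And>x Z. R x (g x) Z"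
proof -
  define f where "f x = (LEAST U. \<forall>z<2 ^ U. R x U (set_decode z))" for x
  have iff: "(\<forall>z<2 ^ U. R x U (set_decode z)) \<longleftrightarrow> (\<forall>Z. R x U Z)" for x U
  proof
    assume *: "\<forall>z<2 ^ U. R x U (set_decode z)"
    show "\<forall>Z. R x U Z"
    proof
      fix Z
      have "set_encode (Z \<inter> {..<U}) < 2 ^ U"
        by (rule set_encode_less) simp
      moreover have "set_decode (set_encode (Z \<inter> {..<U})) = Z \<inter> {..<U}"
        by (rule set_encode_inverse) simp
      ultimately have "R x U (Z \<inter> {..<U})" using * by metis
      then show "R x U Z"
        using open_family_local[OF R, of "Z \<inter> {..<U}" U Z x] by simp
    qed
  qed blast
  have ex: "\<exists>U. \<forall>Z. R x U Z" for x
  proof (rule cantor_compact)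
    show "R x u Z = R x u Z'" if "Z \<inter> {..<u} = Z' \<inter> {..<u}" for u Z Z'
      using that by (rule open_family_local[OF R])
    show "R x v Z" if "R x u Z" "u \<le> v" for u v Z
      using that by (rule open_family_mono[OF R])
  qed (rule cover)
  have "\<forall>Z. R x (f x) Z" for x
    unfolding f_def iff by (rule LeastI_ex[of "\<lambda>U. \<forall>Z. R x U Z"]) (rule ex)
  then have f: "R x (f x) Z" for x Z ..
  have "comp_in orc f"
    unfolding f_def
  proof (rule comp_in_Least)
    show "dec_in orc (\<lambda>w. \<forall>z<2 ^ psnd w. R (pfst w) (psnd w) (set_decode z))"
      by (intro dec_in_compose3[of _ "\<lambda>x u z. R x u (set_decode z)", OF open_family_dec[OF R]] comp_intros)
  qed (use ex in blast)
  then obtain g where "comp_in zero g" "\<And>x. f x \<le> g x"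
    using \<open>tame orc\<close> unfolding tame_def by blast
  with f open_family_mono[OF R] that show ?thesis by blast
qed

text \<open>Parity carries \<open>Z\<close> and the half carries \<open>orc\<close>. The value at
  \<open>n\<close> depends on \<open>Z\<close> only at \<open>n\<close>, so a bound on queries is
  also a bound on the bits of \<open>Z\<close> used.\<close>

definition join :: "(nat \<Rightarrow> nat) \<Rightarrow> nat set \<Rightarrow> nat \<Rightarrow> nat" where
  "join orc Z n = (if n \<in> Z then Suc (orc n + orc n) else orc n + orc n)"

lemma comp_in_join_oracle: "comp_in (join orc Z) orc"
proof -
  let ?P = "\<lambda>x n. join orc Z x = n + n \<or> join orc Z x = Suc (n + n)"
  have "(LEAST n. ?P x n) = orc x" for x
  proof (rule Least_equality)
    show "orc x \<le> n" if "?P x n" for n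
      using that by (simp add: join_def split: if_splits) presburger+
  qed (simp add: join_def)
  moreover have "comp_in (join orc Z) (\<lambda>x. LEAST n. ?P x n)"
  proof (rule comp_in_Least)
    show "dec_in (join orc Z) (\<lambda>w. ?P (pfst w) (psnd w))" by (intro comp_intros)
    show "\<exists>n. ?P x n" for x by (auto simp: join_def)
  qed
  ultimately show ?thesis by simp
qed

lemma dec_in_join_set: "dec_in (join orc Z) (\<lambda>x. x \<in> Z)"
proof -
  have double_not_odd: "a + a \<noteq> Suc (n + n)" for a n :: nat
    by presburger
  have "x \<in> Z \<longleftrightarrow> (\<exists>n<Suc (join orc Z x). join orc Z x = Suc (n + n))" for x
    using double_not_odd by (auto simp: join_def intro!: exI[of _ "orc x"])
  moreover have "dec_in (join orc Z) (\<lambda>x. \<exists>n<Suc (join orc Z x). join orc Z x = Suc (n + n))"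
    by (intro comp_intros)
  ultimately show ?thesis by simp
qed

text \<open>One bound limits the computation, its queries and its output. The set of such
  \<open>Z\<close> is therefore local, and \<open>u\<close> bounds the value.\<close>

definition halts_within :: "(nat \<Rightarrow> nat) \<Rightarrow> rf \<Rightarrow> nat \<Rightarrow> nat \<Rightarrow> nat set \<Rightarrow> bool" where
  "halts_within orc p x u Z \<longleftrightarrow>
     (\<exists>d<u. justified (\<lambda>q y. q < u \<and> y = join orc Z q) (set_decode d) \<and>
            (\<exists>y<u. triple (rf_code p) x y \<in> set_decode d))"

lemma open_family_halts_within: "open_family orc (halts_within orc p)"
proof (rule open_familyI)
  show "dec_in orc (\<lambda>w. halts_within orc p (pfst w) (pfst (psnd w)) (set_decode (psnd (psnd w))))"
    unfolding halts_within_def join_def by (intro dec_in_justified dec_in_mem_triple comp_intros)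
  show "halts_within orc p x u Z = halts_within orc p x u Z'"
    if "Z \<inter> {..<u} = Z' \<inter> {..<u}" for x u Z Z'
  proof -
    have "(\<lambda>q y. q < u \<and> y = join orc Z q) = (\<lambda>q y. q < u \<and> y = join orc Z' q)"
      using that by (auto simp: join_def fun_eq_iff)
    then show ?thesis unfolding halts_within_def by simp
  qed
  show "halts_within orc p x v Z" if h: "halts_within orc p x u Z" and "u \<le> v" for x u v Z
  proof -
    obtain d y where d: "d < u" "justified (\<lambda>q y. q < u \<and> y = join orc Z q) (set_decode d)"
      "y < u" "triple (rf_code p) x y \<in> set_decode d"
      using h unfolding halts_within_def by blast
    from d(2) have "justified (\<lambda>q y. q < v \<and> y = join orc Z q) (set_decode d)"
      by (rule justified_mono) (use \<open>u \<le> v\<close> in auto)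
    with d \<open>u \<le> v\<close> show ?thesis unfolding halts_within_def by (meson less_le_trans)
  qed
qed

lemma halts_within_imp_ev:
  assumes "halts_within orc p x u Z"
  shows "\<exists>y<u. ev (join orc Z) p x y"
proof -
  obtain d y where d: "justified (\<lambda>q y. q < u \<and> y = join orc Z q) (set_decode d)"
    and y: "y < u" "triple (rf_code p) x y \<in> set_decode d"
    using assms unfolding halts_within_def by blast
  have "ev (join orc Z) p x y"
    by (rule justified_sound[OF d _ y(2)]) simp
  with y(1) show ?thesis by blast
qed

lemma ev_imp_halts_within:
  assumes "ev (join orc Z) p x y"
  shows "\<exists>u. halts_within orc p x u Z"
proof -
  obtain d u0 where d: "triple (rf_code p) x y \<in> set_decode d"
    "\<And>u. u0 \<le> u \<Longrightarrow> justified (\<lambda>q y. q < u \<and> y = join orc Z q) (set_decode d)"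
    using justified_complete[OF assms] by metis
  have "halts_within orc p x (Suc (d + y + u0)) Z"
    unfolding halts_within_def using d(1) d(2)[of "Suc (d + y + u0)"]
    by (intro exI[of _ d] exI[of _ y] conjI) auto
  then show ?thesis ..
qed

text \<open>One step of the hyperimmune-free basis theorem: either some member of the class makes the
  program diverge at some argument, and the class can be shrunk to such members, or compactness
  bounds the values of the program over the whole class.\<close>

lemma basis_step:
  assumes "tame orc" and R: "open_family orc (\<lambda>_. R)" and ne: "\<exists>Z. \<forall>u. \<not> R u Z"
  obtains R' where "open_family orc (\<lambda>_. R')" "\<exists>Z. \<forall>u. \<not> R' u Z" "\<And>u Z. R u Z \<Longrightarrow> R' u Z"
    "\<And>Z. \<forall>u. \<not> R' u Z \<Longrightarrow> (\<exists>x. \<forall>y. \<not> ev (join orc Z) p x y) \<or>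
       (\<exists>g. comp_in zero g \<and> (\<forall>x. \<exists>y\<le>g x. ev (join orc Z) p x y))"
proof (cases "\<exists>x Z. (\<forall>u. \<not> R u Z) \<and> (\<forall>u. \<not> halts_within orc p x u Z)")
  case True
  then obtain x Z where xZ: "\<forall>u. \<not> R u Z" "\<forall>u. \<not> halts_within orc p x u Z" by blast
  show ?thesis
  proof (rule that)
    show "open_family orc (\<lambda>_ u Z. R u Z \<or> halts_within orc p x u Z)"
      using open_family_disj[OF R open_family_fix[OF open_family_halts_within]] .
    show "\<exists>Z. \<forall>u. \<not> (R u Z \<or> halts_within orc p x u Z)"
      using xZ by blast
    show "(\<exists>x. \<forall>y. \<not> ev (join orc Z) p x y) \<or>
       (\<exists>g. comp_in zero g \<and> (\<forall>x. \<exists>y\<le>g x. ev (join orc Z) p x y))"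
      if "\<forall>u. \<not> (R u Z \<or> halts_within orc p x u Z)" for Z
      using that ev_imp_halts_within by blast
  qed blast
next
  case False
  have "open_family orc (\<lambda>x u Z. R u Z \<or> halts_within orc p x u Z)"
    using open_family_disj[OF R open_family_halts_within] .
  moreover have "\<exists>u. R u Z \<or> halts_within orc p x u Z" for x Z
    using False by blast
  ultimately obtain g where g: "comp_in zero g" "\<And>x Z. R (g x) Z \<or> halts_within orc p x (g x) Z"
    using open_family_bound[of orc "\<lambda>x u Z. R u Z \<or> halts_within orc p x u Z"] \<open>tame orc\<close> by metis
  \<comment> \<open>The class is kept as it is: its members never satisfy \<open>R\<close>, so
    \<open>g x\<close> must be a bound for the halting of the program.\<close>
  show ?thesis
  proof (rule that[OF R ne])
    show "(\<exists>x. \<forall>y. \<not> ev (join orc Z) p x y) \<or>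
       (\<exists>g. comp_in zero g \<and> (\<forall>x. \<exists>y\<le>g x. ev (join orc Z) p x y))"
      if "\<forall>u. \<not> R u Z" for Z
      using that g halts_within_imp_ev less_imp_le by meson
  qed
qed

text \<open>Apply the one-step lemma to all programs in turn. The resulting decreasing sequence of
  non-empty closed classes has a common member by compactness.\<close>

theorem hyperimmune_free_basis:
  assumes "tame orc" and R: "open_family orc (\<lambda>_. R)" and ne: "\<exists>Z. \<forall>u. \<not> R u Z"
  obtains Z where "\<forall>u. \<not> R u Z" "tame (join orc Z)"
proof -
  define cls where "cls R' \<longleftrightarrow> open_family orc (\<lambda>_. R') \<and> (\<exists>Z. \<forall>u. \<not> R' u Z) \<and> (\<forall>u Z. R u Z \<longrightarrow> R' u Z)"
    for R'

  \<comment> \<open>Program number \<open>n\<close> is either partial on this oracle or has values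
    below a computable function; \<open>inv rf_code\<close> reaches every program.\<close>
  define dec where "dec n Z \<longleftrightarrow> (\<exists>x. \<forall>y. \<not> ev (join orc Z) (inv rf_code n) x y) \<or>
       (\<exists>g. comp_in zero g \<and> (\<forall>x. \<exists>y\<le>g x. ev (join orc Z) (inv rf_code n) x y))" for n Z
  have "\<exists>f. \<forall>n. cls (f n) \<and> ((\<forall>u Z. f n u Z \<longrightarrow> f (Suc n) u Z) \<and>
      (\<forall>Z. (\<forall>u. \<not> f (Suc n) u Z) \<longrightarrow> dec n Z))"
  proof (rule dependent_nat_choice[where P = "\<lambda>_. cls"])
    show "\<exists>R'. cls R'" using R ne unfolding cls_def by blast
    show "\<exists>R''. cls R'' \<and> (\<forall>u Z. R' u Z \<longrightarrow> R'' u Z) \<and> (\<forall>Z. (\<forall>u. \<not> R'' u Z) \<longrightarrow> dec n Z)"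
      if "cls R'" for R' n
    proof -
      have R': "open_family orc (\<lambda>_. R')" "\<exists>Z. \<forall>u. \<not> R' u Z" "\<And>u Z. R u Z \<Longrightarrow> R' u Z"
        using that unfolding cls_def by blast+
      obtain R'' where "open_family orc (\<lambda>_. R'')" "\<exists>Z. \<forall>u. \<not> R'' u Z"
        "\<And>u Z. R' u Z \<Longrightarrow> R'' u Z" "\<And>Z. \<forall>u. \<not> R'' u Z \<Longrightarrow> dec n Z"
        using basis_step[OF \<open>tame orc\<close> R'(1,2), of "inv rf_code n"] unfolding dec_def by metis
      with R'(3) show ?thesis unfolding cls_def by (intro exI[of _ R'']) blast
    qed
  qed
  then obtain f where f: "\<And>n. cls (f n)" "\<And>n u Z. f n u Z \<Longrightarrow> f (Suc n) u Z"
    "\<And>n Z. \<forall>u. \<not> f (Suc n) u Z \<Longrightarrow> dec n Z" by blast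
  have "\<exists>Z. \<forall>n u. \<not> f n u Z"
  proof (rule nested_classes_meet)
    show "f n u Z = f n u Z'" if "Z \<inter> {..<u} = Z' \<inter> {..<u}" for n u Z Z'
      using f(1)[of n] open_family_local[of orc "\<lambda>_. f n", OF _ that] unfolding cls_def by blast
    show "f n v Z" if "f n u Z" "u \<le> v" for n u v Z
      using f(1)[of n] open_family_mono[of orc "\<lambda>_. f n", OF _ that] unfolding cls_def by blast
    show "\<exists>Z. \<forall>u. \<not> f n u Z" for n using f(1)[of n] unfolding cls_def by blast
  qed (rule f(2))
  then obtain Z where Z: "\<And>n u. \<not> f n u Z" by blast
  show ?thesis
  proof (rule that)
    show "\<forall>u. \<not> R u Z" using Z[of 0] f(1)[of 0] unfolding cls_def by blast
    show "tame (join orc Z)"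
      unfolding tame_def
    proof (intro allI impI)
      fix h assume "comp_in (join orc Z) h"
      then obtain p where p: "\<And>x. ev (join orc Z) p x (h x)" unfolding comp_in_def by blast
      \<comment> \<open>As \<open>p\<close> is total on this oracle, the divergent alternative is
        excluded.\<close>
      have "dec (rf_code p) Z" using f(3) Z by blast
      then obtain g where g: "comp_in zero g" "\<And>x. \<exists>y\<le>g x. ev (join orc Z) p x y"
        unfolding dec_def inv_f_f[OF inj_rf_code] using p by blast
      have "h x \<le> g x" for x using g(2)[of x] ev_deterministic[OF p[of x]] by blast
      with g(1) show "\<exists>g. comp_in zero g \<and> (\<forall>x. h x \<le> g x)" by blast
    qed
  qed
qed

section \<open>Trees computed from a homogeneous set\<close>

lemma tree_iso_incomparable:
  assumes "tree_iso S"
  obtains s t where "s \<in> S" "t \<in> S" "\<not> prefix s t" "\<not> prefix t s"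
proof -
  obtain g where g: "bij_betw g UNIV S" "\<forall>s t :: bool list. prefix s t \<longleftrightarrow> prefix (g s) (g t)"
    using assms unfolding tree_iso_def by blast
  have "\<not> prefix (g [True]) (g [False])" "\<not> prefix (g [False]) (g [True])"
    unfolding g(2)[rule_format, symmetric] by simp_all
  then show ?thesis using that g(1) by (metis UNIV_I bij_betw_apply)
qed

text \<open>The images of the strings \<open>s' @ replicate n True\<close> are distinct and lie
  above \<open>s\<close>, so their codes are unbounded.\<close>

lemma tree_iso_unbounded_above:
  assumes "tree_iso S" "s \<in> S"
  obtains t where "t \<in> S" "prefix s t" "l < scode t"
proof -
  obtain g where g: "bij_betw g UNIV S" "\<forall>s t :: bool list. prefix s t \<longleftrightarrow> prefix (g s) (g t)"
    using assms unfolding tree_iso_def by blast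
  obtain s' where s': "s = g s'" using g(1) assms(2) by (metis bij_betw_imp_surj_on imageE)
  have "inj (\<lambda>n. scode (g (s' @ replicate n True)))"
  proof (rule injI)
    fix m n assume "scode (g (s' @ replicate m True)) = scode (g (s' @ replicate n True))"
    then have "s' @ replicate m True = s' @ replicate n True"
      using inj_scode g(1) by (metis bij_betw_imp_inj_on injD)
    then show "m = n" by (metis length_replicate same_append_eq)
  qed
  then have "infinite (range (\<lambda>n. scode (g (s' @ replicate n True))))"
    by (simp add: finite_image_iff)
  then obtain n where "l < scode (g (s' @ replicate n True))"
    unfolding infinite_nat_iff_unbounded by blast
  moreover have "g (s' @ replicate n True) \<in> S" using g(1) by (metis UNIV_I bij_betw_apply)
  moreover have "prefix s (g (s' @ replicate n True))" unfolding s' g(2)[rule_format, symmetric] by simp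
  ultimately show ?thesis using that by blast
qed

text \<open>The Boolean \<open>c\<close> is the colour of the tree: \<open>True\<close> stands for
  \<open>follower\<close>, \<open>False\<close> for its complement.\<close>

definition computes_tree :: "rf \<Rightarrow> nat set \<Rightarrow> bool \<Rightarrow> bool" where
  "computes_tree p H c \<longleftrightarrow> (\<exists>S. tree_iso S \<and> (\<forall>s\<in>S. scode s \<in> follower \<longleftrightarrow> c) \<and>
     (\<forall>x. ev (chi H) p x (chi (codeset S) x)))"

lemma scode_in_codeset [simp]: "scode s \<in> codeset S \<longleftrightarrow> s \<in> S"
  unfolding codeset_def by (simp add: inj_image_mem_iff[OF inj_scode])

lemma ev_codeset:
  assumes "\<forall>x. ev (chi H) p x (chi (codeset S) x)"
  shows "ev (chi H) p (scode s) 1 \<longleftrightarrow> s \<in> S"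
proof
  assume "ev (chi H) p (scode s) 1"
  from ev_deterministic[OF this assms[rule_format]] show "s \<in> S"
    by (simp add: chi_def split: if_splits)
next
  assume "s \<in> S"
  then show "ev (chi H) p (scode s) 1"
    using assms[rule_format, of "scode s"] by (simp add: chi_def)
qed

lemma computes_tree_colour:
  "computes_tree p H c \<Longrightarrow> ev (chi H) p (scode s) 1 \<Longrightarrow> scode s \<in> follower \<longleftrightarrow> c"
  unfolding computes_tree_def by (metis ev_codeset)

lemma computes_tree_incomparable:
  assumes "computes_tree p H c"
  obtains s t where "ev (chi H) p (scode s) 1" "ev (chi H) p (scode t) 1" "\<not> prefix s t" "\<not> prefix t s"
  using assms unfolding computes_tree_def by (metis ev_codeset tree_iso_incomparable)

lemma computes_tree_unbounded_above:
  assumes "computes_tree p H c" "ev (chi H) p (scode s) 1"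
  obtains t where "ev (chi H) p (scode t) 1" "prefix s t" "l < scode t"
  using assms unfolding computes_tree_def by (metis ev_codeset tree_iso_unbounded_above)

text \<open>The next element of the tree above a fixed node is found within a computable bound, and
  fairness gives the whole search interval the wrong colour. This keeps reservoirs infinite on both
  sides of the partition.\<close>

lemma tame_computes_no_tree:
  assumes "tame orc" "dec_in orc (\<lambda>x. x \<in> H)"
  shows "\<not> computes_tree p H c"
proof
  assume "computes_tree p H c"
  then obtain S where S: "tree_iso S" "\<And>s. s \<in> S \<Longrightarrow> scode s \<in> follower \<longleftrightarrow> c"
    and p: "\<And>x. ev (chi H) p x (chi (codeset S) x)"
    unfolding computes_tree_def by blast
  have chi: "chi X = (\<lambda>x. of_bool (x \<in> X))" for X by (auto simp: chi_def)
  have H: "comp_in orc (chi H)" using assms(2) unfolding dec_in_def chi .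
  have "comp_in (chi H) (chi (codeset S))" using p unfolding comp_in_def by blast
  from comp_in_trans[OF H this] have decS: "dec_in orc (\<lambda>x. x \<in> codeset S)"
    unfolding dec_in_def chi .
  obtain s where s: "s \<in> S" using tree_iso_incomparable[OF S(1)] by blast
  let ?P = "\<lambda>l x. l < x \<and> x \<in> codeset S \<and> code_prefix (scode s) x"
  have ex: "\<exists>x. ?P l x" for l
    using tree_iso_unbounded_above[OF S(1) s, of l] by (metis code_prefix_scode scode_in_codeset)
  have "comp_in orc (\<lambda>l. LEAST x. ?P l x)"
    by (intro comp_in_Least ex dec_in_code_prefix dec_in_compose[OF decS] comp_intros)
  then obtain g where g: "comp_in zero g" "\<And>l. (LEAST x. ?P l x) \<le> g l"
    using \<open>tame orc\<close> unfolding tame_def by blast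
  \<comment> \<open>The empty set keeps the interval out of \<open>follower\<close>; the singleton
    puts the cone above \<open>s\<close> into it.\<close>
  have "finite (if c then {} else {scode s})" by simp
  from follower_fair[OF g(1) this] obtain l where l: "\<forall>x. l < x \<and> x \<le> g l \<longrightarrow>
      (x \<in> follower \<longleftrightarrow> (\<exists>t\<in>if c then {} else {scode s}. code_prefix t x))" ..
  define x where "x = (LEAST x. ?P l x)"
  have x: "?P l x" unfolding x_def by (rule LeastI_ex) (rule ex)
  then obtain t where "t \<in> S" "x = scode t" unfolding codeset_def by blast
  with S(2) l[rule_format, of x] x g(2)[of l] show False
    by (auto simp: x_def[symmetric] split: if_splits)
qed

section \<open>Forcing\<close>

text \<open>The sets compatible with the Mathias condition with stem \<open>F\<close> and reservoir
  \<open>X\<close>.\<close>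

definition mathias :: "nat set \<Rightarrow> nat set \<Rightarrow> nat set set" where
  "mathias F X = {H. F \<subseteq> H \<and> H \<subseteq> F \<union> X}"

lemma ev_use:
  assumes "ev (chi H) p x y"
  obtains u where "\<And>H'. H' \<inter> {..<u} = H \<inter> {..<u} \<Longrightarrow> ev (chi H') p x y"
proof -
  obtain d u where d: "triple (rf_code p) x y \<in> set_decode d"
    and j: "justified (\<lambda>q y. q < u \<and> y = chi H q) (set_decode d)"
    using justified_complete[OF assms] by (metis le_refl)
  show ?thesis
  proof (rule that)
    show "ev (chi H') p x y" if "H' \<inter> {..<u} = H \<inter> {..<u}" for H'
      by (rule justified_sound[OF j _ d]) (use that in \<open>auto simp: chi_def\<close>)
  qed
qed

lemma mathias_agree:
  assumes "H \<in> mathias F X" "H' \<in> mathias (F \<union> (H \<inter> {..<u})) (X' \<inter> {u..})"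
  shows "H' \<inter> {..<u} = H \<inter> {..<u}"
  using assms unfolding mathias_def by auto

text \<open>A tree has two incomparable nodes. Moving \<open>H\<close> below the use of both
  computations into the stem makes all remaining sets agree with \<open>H\<close> there.\<close>

lemma force_incomparable:
  assumes "H \<in> mathias F X" "computes_tree p H c" "finite F"
  obtains E u s t where "finite E" "E \<subseteq> X" "\<not> prefix s t" "\<not> prefix t s"
    "\<And>H. H \<in> mathias (F \<union> E) (X \<inter> {u..}) \<Longrightarrow>
       ev (chi H) p (scode s) 1 \<and> ev (chi H) p (scode t) 1"
proof -
  obtain s t where st: "ev (chi H) p (scode s) 1" "ev (chi H) p (scode t) 1"
      "\<not> prefix s t" "\<not> prefix t s"
    using computes_tree_incomparable[OF assms(2)] by blast
  obtain u1 where u1: "\<And>H'. H' \<inter> {..<u1} = H \<inter> {..<u1} \<Longrightarrow> ev (chi H') p (scode s) 1"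
    using ev_use[OF st(1)] by blast
  obtain u2 where u2: "\<And>H'. H' \<inter> {..<u2} = H \<inter> {..<u2} \<Longrightarrow> ev (chi H') p (scode t) 1"
    using ev_use[OF st(2)] by blast
  let ?u = "max u1 u2"
  let ?E = "H \<inter> {..<?u} - F"
  show ?thesis
  proof (rule that)
    show "finite ?E" by simp
    show "?E \<subseteq> X" using assms(1) unfolding mathias_def by blast
    fix H' assume "H' \<in> mathias (F \<union> ?E) (X \<inter> {?u..})"
    then have "H' \<inter> {..<?u} = H \<inter> {..<?u}"
      using mathias_agree[OF assms(1), of H' ?u X] by simp
    then have "H' \<inter> {..<v} = H \<inter> {..<v}" if "v \<le> ?u" for v
      using that by (metis Int_assoc inf.absorb2 lessThan_subset_iff)
    then have "H' \<inter> {..<u1} = H \<inter> {..<u1}" "H' \<inter> {..<u2} = H \<inter> {..<u2}"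
      by simp_all
    then show "ev (chi H') p (scode s) 1 \<and> ev (chi H') p (scode t) 1" using u1 u2 by blast
  qed (use st in blast)+
qed

text \<open>A search bounded by \<open>u\<close>: \<open>e\<close> codes a finite extension of the
  stem inside \<open>X\<close> and \<open>W\<close>, and \<open>d\<close> codes a computation that
  accepts \<open>x\<close>. The answers are those of the extended stem, and \<open>W\<close> is read
  only below \<open>u\<close>.\<close>

definition finds :: "nat set \<Rightarrow> rf \<Rightarrow> nat \<Rightarrow> nat set \<Rightarrow> nat \<Rightarrow> nat \<Rightarrow> nat set \<Rightarrow> bool" where
  "finds F p a X l u W \<longleftrightarrow> (\<exists>e<u. \<exists>x<u. l < x \<and> code_prefix a x \<and>
     (\<forall>i<u. i \<in> set_decode e \<longrightarrow> i \<in> X \<and> i \<in> W) \<and>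
     (\<exists>d<u. triple (rf_code p) x 1 \<in> set_decode d \<and>
        justified (\<lambda>q y. q < u \<and> y = chi (F \<union> set_decode e) q) (set_decode d)))"

lemma finds_imp_ev:
  assumes "finds F p a X l u W"
  obtains E x where "finite E" "E \<subseteq> X \<inter> W" "l < x" "x < u" "code_prefix a x"
    "\<forall>H\<in>mathias (F \<union> E) {u..}. ev (chi H) p x 1"
proof -
  obtain e x d where e: "e < u" "\<And>i. i < u \<Longrightarrow> i \<in> set_decode e \<Longrightarrow> i \<in> X \<and> i \<in> W"
    and x: "x < u" "l < x" "code_prefix a x"
    and d: "triple (rf_code p) x 1 \<in> set_decode d"
      "justified (\<lambda>q y. q < u \<and> y = chi (F \<union> set_decode e) q) (set_decode d)"
    using assms unfolding finds_def by blast
  show ?thesis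
  proof (rule that)
    show "finite (set_decode e)" by simp
    show "set_decode e \<subseteq> X \<inter> W" using e mem_set_decode_less less_trans by blast
    show "\<forall>H\<in>mathias (F \<union> set_decode e) {u..}. ev (chi H) p x 1"
    proof
      show "ev (chi H) p x 1" if "H \<in> mathias (F \<union> set_decode e) {u..}" for H
        by (rule justified_sound[OF d(2) _ d(1)]) (use that in \<open>auto simp: chi_def mathias_def\<close>)
    qed
  qed (fact x)+
qed

lemma ev_imp_finds:
  assumes "H \<in> mathias F (X \<inter> W)" "ev (chi H) p x 1" "l < x" "code_prefix a x"
  shows "\<exists>u. finds F p a X l u W"
proof -
  obtain d u0 where d: "triple (rf_code p) x 1 \<in> set_decode d"
    "justified (\<lambda>q y. q < u0 \<and> y = chi H q) (set_decode d)"
    using justified_complete[OF assms(2)] by (metis le_refl)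
  define e where "e = set_encode (H \<inter> {..<u0} - F)"
  have e: "set_decode e = H \<inter> {..<u0} - F"
    unfolding e_def by (rule set_encode_inverse) simp
  let ?u = "Suc (d + u0 + x + e)"
  \<comment> \<open>All queries in \<open>d\<close> are below \<open>u0\<close>, where
    \<open>H\<close> and the extended stem agree.\<close>
  have "justified (\<lambda>q y. q < ?u \<and> y = chi (F \<union> set_decode e) q) (set_decode d)"
    by (rule justified_mono[OF d(2)]) (use assms(1) e in \<open>auto simp: chi_def mathias_def\<close>)
  moreover have "i \<in> X \<and> i \<in> W" if "i \<in> set_decode e" for i
    using that assms(1) e unfolding mathias_def by auto
  ultimately have "finds F p a X l ?u W"
    unfolding finds_def using assms(3,4) d(1)
    by (intro exI[of _ e] exI[of _ x] exI[of _ d] conjI) auto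
  then show ?thesis ..
qed

text \<open>The Boolean \<open>s\<close> selects a half of the splitting, so one lemma serves the
  programs of both sides.\<close>

lemma open_family_finds:
  assumes X: "dec_in orc (\<lambda>x. x \<in> X)" and F: "finite F"
  shows "open_family orc (\<lambda>l u Z. finds F p a X l u (if s then Z else - Z))"
proof (rule open_familyI)
  have mem: "i \<in> (if s then Z else - Z) \<longleftrightarrow> (s \<and> i \<in> Z) \<or> (\<not> s \<and> i \<notin> Z)" for i :: nat and Z
    by simp
  have chi: "chi (F \<union> set_decode e) q =
      (if q \<in> set_decode (set_encode F) \<or> q \<in> set_decode e then 1 else 0)" for e q
    using F by (simp add: chi_def set_encode_inverse)
  show "dec_in orc (\<lambda>w. finds F p a X (pfst w) (pfst (psnd w))
      (if s then set_decode (psnd (psnd w)) else - set_decode (psnd (psnd w))))"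
    unfolding finds_def mem chi
    by (intro dec_in_code_prefix dec_in_mem_triple dec_in_justified dec_in_compose[OF X] comp_intros)
  show "finds F p a X l u (if s then Z else - Z) = finds F p a X l u (if s then Z' else - Z')"
    if "Z \<inter> {..<u} = Z' \<inter> {..<u}" for l u Z Z'
  proof -
    have "i \<in> (if s then Z else - Z) \<longleftrightarrow> i \<in> (if s then Z' else - Z')" if "i < u" for i
      using \<open>Z \<inter> {..<u} = Z' \<inter> {..<u}\<close> that by (auto simp: set_eq_iff)
    then have "(\<forall>i<u. i \<in> set_decode e \<longrightarrow> i \<in> X \<and> i \<in> (if s then Z else - Z)) \<longleftrightarrow>
        (\<forall>i<u. i \<in> set_decode e \<longrightarrow> i \<in> X \<and> i \<in> (if s then Z' else - Z'))" for e
      by blast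
    then show ?thesis unfolding finds_def by (simp only:)
  qed
  show "finds F p a X l v (if s then Z else - Z)"
    if f: "finds F p a X l u (if s then Z else - Z)" and "u \<le> v" for l u v Z
  proof -
    let ?W = "if s then Z else - Z"
    obtain e x d where e: "e < u" "\<And>i. i < u \<Longrightarrow> i \<in> set_decode e \<Longrightarrow> i \<in> X \<and> i \<in> ?W"
      and x: "x < u" "l < x" "code_prefix a x"
      and d: "d < u" "triple (rf_code p) x 1 \<in> set_decode d"
        "justified (\<lambda>q y. q < u \<and> y = chi (F \<union> set_decode e) q) (set_decode d)"
      using f unfolding finds_def by blast
    have "justified (\<lambda>q y. q < v \<and> y = chi (F \<union> set_decode e) q) (set_decode d)"
      by (rule justified_mono[OF d(3)]) (use \<open>u \<le> v\<close> in auto)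
    moreover have "i \<in> X \<and> i \<in> ?W" if "i \<in> set_decode e" for i
      using that e mem_set_decode_less less_trans by blast
    ultimately show ?thesis
      unfolding finds_def using x d(1,2) e(1) \<open>u \<le> v\<close>
      by (intro exI[of _ e] exI[of _ x] exI[of _ d] conjI) auto
  qed
qed

section \<open>Conditions with two stems and a common reservoir, and their requirements\<close>

definition condition :: "nat set \<Rightarrow> nat set \<Rightarrow> nat set \<Rightarrow> nat set \<Rightarrow> (nat \<Rightarrow> nat) \<Rightarrow> bool" where
  "condition B F0 F1 X orc \<longleftrightarrow> finite F0 \<and> finite F1 \<and> F0 \<subseteq> B \<and> F1 \<subseteq> - B \<and>
     infinite X \<and> dec_in orc (\<lambda>x. x \<in> X) \<and> tame orc"

definition extends :: "nat set \<Rightarrow> nat set \<Rightarrow> nat set \<Rightarrow> nat set \<Rightarrow> nat set \<Rightarrow> nat set \<Rightarrow> bool" where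
  "extends F0' F1' X' F0 F1 X \<longleftrightarrow>
     F0 \<subseteq> F0' \<and> F0' \<subseteq> F0 \<union> X \<and> F1 \<subseteq> F1' \<and> F1' \<subseteq> F1 \<union> X \<and> X' \<subseteq> X"

text \<open>The requirement is disjunctive: it defeats one of two programs without saying which.
  That suffices for a contradiction once both sides are assumed to compute trees.\<close>

definition avoids ::
    "nat set \<Rightarrow> nat set \<Rightarrow> nat set \<Rightarrow> nat set \<Rightarrow> rf \<Rightarrow> bool \<Rightarrow> rf \<Rightarrow> bool \<Rightarrow> bool" where
  "avoids B F0 F1 X p0 k0 p1 k1 \<longleftrightarrow>
     (\<forall>H0\<in>mathias F0 (X \<inter> B). \<forall>H1\<in>mathias F1 (X \<inter> - B).
        \<not> (computes_tree p0 H0 k0 \<and> computes_tree p1 H1 k1))"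

lemma extends_refl: "extends F0 F1 X F0 F1 X"
  by (auto simp: extends_def)

lemma extends_trans:
  "extends F0'' F1'' X'' F0' F1' X' \<Longrightarrow> extends F0' F1' X' F0 F1 X \<Longrightarrow> extends F0'' F1'' X'' F0 F1 X"
  unfolding extends_def by blast

lemma condition_extend:
  assumes "condition B F0 F1 X orc" "finite E0" "E0 \<subseteq> X \<inter> B" "finite E1" "E1 \<subseteq> X \<inter> - B"
  shows "condition B (F0 \<union> E0) (F1 \<union> E1) (X \<inter> {u..}) orc"
    and "extends (F0 \<union> E0) (F1 \<union> E1) (X \<inter> {u..}) F0 F1 X"
proof -
  have "infinite (X - {..<u})"
    using assms(1) unfolding condition_def by (intro Diff_infinite_finite) auto
  moreover have "X - {..<u} = X \<inter> {u..}" by auto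
  ultimately have "infinite (X \<inter> {u..})" by simp
  moreover have "dec_in orc (\<lambda>x. x \<in> X \<inter> {u..})"
    using assms(1) unfolding condition_def Int_iff atLeast_iff by (intro dec_in_conj comp_intros) auto
  ultimately show "condition B (F0 \<union> E0) (F1 \<union> E1) (X \<inter> {u..}) orc"
    using assms unfolding condition_def by blast
  show "extends (F0 \<union> E0) (F1 \<union> E1) (X \<inter> {u..}) F0 F1 X"
    using assms unfolding extends_def by blast
qed

lemma mathias_mono: "H \<in> mathias F X \<Longrightarrow> X \<subseteq> Y \<Longrightarrow> H \<in> mathias F Y"
  unfolding mathias_def by blast

lemma finds_above:
  assumes "H \<in> mathias F (X \<inter> W)" "computes_tree p H c" "ev (chi H) p (scode a) 1"
  shows "\<exists>u. finds F p (scode a) X l u W"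
proof -
  obtain t where "ev (chi H) p (scode t) 1" "prefix a t" "l < scode t"
    using computes_tree_unbounded_above[OF assms(2,3)] .
  then show ?thesis using ev_imp_finds[OF assms(1)] by simp
qed

text \<open>With \<open>a\<close> and \<open>b\<close> already accepted, trees must continue above
  them to arbitrarily large codes. Either some splitting blocks this for both programs, or the
  search succeeds within a computable bound for all splittings.\<close>

lemma force_avoidance_above:
  assumes cond: "condition B F0 F1 X orc"
    and ab: "\<not> prefix a b" "\<not> prefix b a"
    and a: "\<And>H. H \<in> mathias F0 (X \<inter> B) \<Longrightarrow> ev (chi H) p0 (scode a) 1"
    and b: "\<And>H. H \<in> mathias F1 (X \<inter> - B) \<Longrightarrow> ev (chi H) p1 (scode b) 1"
  obtains F0' F1' X' orc' where "condition B F0' F1' X' orc'" "extends F0' F1' X' F0 F1 X"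
    "avoids B F0' F1' X' p0 k0 p1 k1"
proof -
  define R where "R l u Z \<longleftrightarrow> finds F0 p0 (scode a) X l u Z \<or> finds F1 p1 (scode b) X l u (- Z)"
    for l u Z
  have fin: "finite F0" "finite F1" and X: "infinite X" "dec_in orc (\<lambda>x. x \<in> X)" and "tame orc"
    using cond unfolding condition_def by blast+
  have R: "open_family orc R"
    using open_family_disj[OF open_family_finds[OF X(2) fin(1), of p0 "scode a" True]
        open_family_finds[OF X(2) fin(2), of p1 "scode b" False]]
    unfolding R_def[abs_def] by simp
  show ?thesis
  proof (cases "\<exists>l Z. \<forall>u. \<not> R l u Z")
    case True
    then obtain l where "\<exists>Z. \<forall>u. \<not> R l u Z" by blast
    with hyperimmune_free_basis[OF \<open>tame orc\<close> open_family_fix[OF R, of l]]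
    obtain Z where Z: "\<forall>u. \<not> R l u Z" "tame (join orc Z)" by blast
    have decX: "dec_in (join orc Z) (\<lambda>x. x \<in> X)"
      by (rule dec_in_trans[OF comp_in_join_oracle X(2)])
    \<comment> \<open>Inside \<open>Z\<close> the first program finds nothing above
      \<open>a\<close>, inside \<open>- Z\<close> the second finds nothing above \<open>b\<close>;
      either half defeats one program.\<close>
    have "X = (X \<inter> Z) \<union> (X \<inter> - Z)" by blast
    then consider "infinite (X \<inter> Z)" | "infinite (X \<inter> - Z)"
      using X(1) by (metis finite_Un)
    then show ?thesis
    proof cases
      case 1
      show ?thesis
      proof (rule that)
        have "dec_in (join orc Z) (\<lambda>x. x \<in> X \<inter> Z)"
          unfolding Int_iff by (intro dec_in_conj decX dec_in_join_set)
        with 1 cond Z(2) show "condition B F0 F1 (X \<inter> Z) (join orc Z)"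
          unfolding condition_def by blast
        show "extends F0 F1 (X \<inter> Z) F0 F1 X" unfolding extends_def by blast
        have "\<not> computes_tree p0 H k0" if H: "H \<in> mathias F0 (X \<inter> Z \<inter> B)" for H
        proof
          assume "computes_tree p0 H k0"
          moreover have "H \<in> mathias F0 (X \<inter> Z)" "H \<in> mathias F0 (X \<inter> B)"
            using H by (auto elim!: mathias_mono)
          ultimately show False
            using finds_above a Z(1) unfolding R_def by blast
        qed
        then show "avoids B F0 F1 (X \<inter> Z) p0 k0 p1 k1" unfolding avoids_def by blast
      qed
    next
      case 2
      show ?thesis
      proof (rule that)
        have "dec_in (join orc Z) (\<lambda>x. x \<in> X \<inter> - Z)"
          unfolding Int_iff Compl_iff by (intro dec_in_conj dec_in_not decX dec_in_join_set)
        with 2 cond Z(2) show "condition B F0 F1 (X \<inter> - Z) (join orc Z)"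
          unfolding condition_def by blast
        show "extends F0 F1 (X \<inter> - Z) F0 F1 X" unfolding extends_def by blast
        have "\<not> computes_tree p1 H k1" if H: "H \<in> mathias F1 (X \<inter> - Z \<inter> - B)" for H
        proof
          assume "computes_tree p1 H k1"
          moreover have "H \<in> mathias F1 (X \<inter> - Z)" "H \<in> mathias F1 (X \<inter> - B)"
            using H by (auto elim!: mathias_mono)
          ultimately show False
            using finds_above b Z(1) unfolding R_def by blast
        qed
        then show "avoids B F0 F1 (X \<inter> - Z) p0 k0 p1 k1" unfolding avoids_def by blast
      qed
    qed
  next
    case False
    then have cover: "\<And>l Z. \<exists>u. R l u Z" by blast
    obtain g where g: "comp_in zero g" "\<And>l Z. R l (g l) Z"
      using open_family_bound[OF R cover \<open>tame orc\<close>] by blast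
    \<comment> \<open>Each cone receives the colour opposite to that of its program's tree. As
      \<open>a\<close> and \<open>b\<close> are incomparable, no string is subject to both
      prescriptions.\<close>
    define V where "V = (if k0 then {} else {scode a}) \<union> (if k1 then {} else {scode b})"
    have "finite V" by (simp add: V_def)
    from follower_fair[OF g(1) this] obtain l where
      l: "\<forall>x. l < x \<and> x \<le> g l \<longrightarrow> (x \<in> follower \<longleftrightarrow> (\<exists>t\<in>V. code_prefix t x))" ..
    have colour: "(prefix a t \<longrightarrow> (scode t \<in> follower \<longleftrightarrow> \<not> k0)) \<and>
        (prefix b t \<longrightarrow> (scode t \<in> follower \<longleftrightarrow> \<not> k1))" if "l < scode t" "scode t < g l" for t
    proof -
      have "scode t \<in> follower \<longleftrightarrow> (\<exists>v\<in>V. code_prefix v (scode t))"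
        using l that by simp
      moreover have "\<not> (prefix a t \<and> prefix b t)"
        using ab prefix_same_cases by blast
      ultimately show ?thesis by (auto simp: V_def)
    qed
    \<comment> \<open>The bound covers all splittings, so it applies to the arbitrary set
      \<open>B\<close> as well.\<close>
    from g(2)[of l B] consider "finds F0 p0 (scode a) X l (g l) B"
      | "finds F1 p1 (scode b) X l (g l) (- B)"
      unfolding R_def by blast
    then show ?thesis
    proof cases
      case 1
      obtain E x where E: "finite E" "E \<subseteq> X \<inter> B" "l < x" "x < g l" "code_prefix (scode a) x"
        "\<forall>H\<in>mathias (F0 \<union> E) {g l..}. ev (chi H) p0 x 1"
        using finds_imp_ev[OF 1] .
      obtain t where t: "x = scode t" using surj_scode by (metis surjD)
      have "\<not> computes_tree p0 H k0" if H: "H \<in> mathias (F0 \<union> E) (X \<inter> {g l..} \<inter> B)" for H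
      proof
        assume "computes_tree p0 H k0"
        moreover have "ev (chi H) p0 (scode t) 1"
          using E(6) mathias_mono[OF H, of "{g l..}"] t by blast
        ultimately have "scode t \<in> follower \<longleftrightarrow> k0"
          by (rule computes_tree_colour)
        with colour[of t] E(3,4,5) t show False by simp
      qed
      then have "avoids B (F0 \<union> E) (F1 \<union> {}) (X \<inter> {g l..}) p0 k0 p1 k1"
        unfolding avoids_def by blast
      with condition_extend[OF cond E(1,2), of "{}" "g l"] show ?thesis
        using that by blast
    next
      case 2
      obtain E x where E: "finite E" "E \<subseteq> X \<inter> - B" "l < x" "x < g l" "code_prefix (scode b) x"
        "\<forall>H\<in>mathias (F1 \<union> E) {g l..}. ev (chi H) p1 x 1"
        using finds_imp_ev[OF 2] .
      obtain t where t: "x = scode t" using surj_scode by (metis surjD)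
      have "\<not> computes_tree p1 H k1" if H: "H \<in> mathias (F1 \<union> E) (X \<inter> {g l..} \<inter> - B)" for H
      proof
        assume "computes_tree p1 H k1"
        moreover have "ev (chi H) p1 (scode t) 1"
          using E(6) mathias_mono[OF H, of "{g l..}"] t by blast
        ultimately have "scode t \<in> follower \<longleftrightarrow> k1"
          by (rule computes_tree_colour)
        with colour[of t] E(3,4,5) t show False by simp
      qed
      then have "avoids B (F0 \<union> {}) (F1 \<union> E) (X \<inter> {g l..}) p0 k0 p1 k1"
        unfolding avoids_def by blast
      with condition_extend[OF cond _ _ E(1,2), of "{}" "g l"] show ?thesis
        using that by blast
    qed
  qed
qed

text \<open>Prefixes of a common string are comparable. If all four cross pairs were comparable, one
  of the two given pairs would be too.\<close>

lemma incomparable_across: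
  assumes "\<not> prefix s t" "\<not> prefix t s" "\<not> prefix s' t'" "\<not> prefix t' s'"
  shows "\<exists>a\<in>{s, t}. \<exists>b\<in>{s', t'}. \<not> prefix a b \<and> \<not> prefix b a"
proof (rule ccontr)
  assume "\<not> ?thesis"
  then have "prefix s s' \<or> prefix s' s" "prefix s t' \<or> prefix t' s"
    "prefix t s' \<or> prefix s' t" "prefix t t' \<or> prefix t' t"
    by auto
  with assms show False
    by (meson prefix_order.trans prefix_same_cases)
qed

text \<open>If the requirement fails, the two counterexamples themselves supply incomparable nodes
  for each program; one from each side can be chosen so that the two are incomparable.\<close>

lemma force_avoidance:
  assumes cond: "condition B F0 F1 X orc"
  obtains F0' F1' X' orc' where "condition B F0' F1' X' orc'" "extends F0' F1' X' F0 F1 X"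
    "avoids B F0' F1' X' p0 k0 p1 k1"
proof (cases "avoids B F0 F1 X p0 k0 p1 k1")
  case True
  with cond extends_refl that show ?thesis by blast
next
  case False
  then obtain H0 H1 where H: "H0 \<in> mathias F0 (X \<inter> B)" "computes_tree p0 H0 k0"
    "H1 \<in> mathias F1 (X \<inter> - B)" "computes_tree p1 H1 k1"
    unfolding avoids_def by blast
  have fin: "finite F0" "finite F1" using cond unfolding condition_def by blast+
  obtain E0 u0 s0 t0 where 0: "finite E0" "E0 \<subseteq> X \<inter> B" "\<not> prefix s0 t0" "\<not> prefix t0 s0"
    "\<And>H. H \<in> mathias (F0 \<union> E0) (X \<inter> B \<inter> {u0..}) \<Longrightarrow>
       ev (chi H) p0 (scode s0) 1 \<and> ev (chi H) p0 (scode t0) 1"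
    using force_incomparable[OF H(1,2) fin(1)] by metis
  obtain E1 u1 s1 t1 where 1: "finite E1" "E1 \<subseteq> X \<inter> - B" "\<not> prefix s1 t1" "\<not> prefix t1 s1"
    "\<And>H. H \<in> mathias (F1 \<union> E1) (X \<inter> - B \<inter> {u1..}) \<Longrightarrow>
       ev (chi H) p1 (scode s1) 1 \<and> ev (chi H) p1 (scode t1) 1"
    using force_incomparable[OF H(3,4) fin(2)] by metis
  let ?u = "max u0 u1"
  obtain a b where ab: "a \<in> {s0, t0}" "b \<in> {s1, t1}" "\<not> prefix a b" "\<not> prefix b a"
    using incomparable_across[OF 0(3,4) 1(3,4)] by blast
  note ext = condition_extend[OF cond 0(1,2) 1(1,2), of ?u]
  have "ev (chi H) p0 (scode a) 1" if "H \<in> mathias (F0 \<union> E0) (X \<inter> {?u..} \<inter> B)" for H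
  proof -
    have "H \<in> mathias (F0 \<union> E0) (X \<inter> B \<inter> {u0..})"
      by (rule mathias_mono[OF that]) auto
    with 0(5) ab(1) show ?thesis by blast
  qed
  moreover have "ev (chi H) p1 (scode b) 1" if "H \<in> mathias (F1 \<union> E1) (X \<inter> {?u..} \<inter> - B)" for H
  proof -
    have "H \<in> mathias (F1 \<union> E1) (X \<inter> - B \<inter> {u1..})"
      by (rule mathias_mono[OF that]) auto
    with 1(5) ab(2) show ?thesis by blast
  qed
  ultimately obtain F0' F1' X' orc' where "condition B F0' F1' X' orc'"
    "extends F0' F1' X' (F0 \<union> E0) (F1 \<union> E1) (X \<inter> {?u..})" "avoids B F0' F1' X' p0 k0 p1 k1"
    using force_avoidance_above[OF ext(1) ab(3,4)] by metis
  with that extends_trans[OF _ ext(2)] show ?thesis by blast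
qed

text \<open>Otherwise \<open>X \<inter> C\<close> would differ from \<open>X\<close> by a finite
  set, so it would be an infinite subset of \<open>C\<close> decidable from a tame oracle, and such
  a set computes no tree.\<close>

lemma condition_infinite:
  assumes "condition B F0 F1 X orc"
    and "\<And>H. infinite H \<Longrightarrow> H \<subseteq> C \<Longrightarrow> \<exists>p c. computes_tree p H c"
  shows "infinite (X \<inter> - C)"
proof
  assume fin: "finite (X \<inter> - C)"
  have X: "infinite X" "dec_in orc (\<lambda>x. x \<in> X)" "tame orc"
    using assms(1) unfolding condition_def by blast+
  have "X \<inter> C = X - (X \<inter> - C)" by blast
  then have "infinite (X \<inter> C)" using X(1) fin by (metis Diff_infinite_finite)
  then obtain p c where "computes_tree p (X \<inter> C) c" using assms(2) by blast
  moreover have "x \<in> X \<inter> C \<longleftrightarrow> x \<in> X \<and> x \<notin> set_decode (set_encode (X \<inter> - C))" for x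
    using set_encode_inverse[OF fin] by blast
  then have "dec_in orc (\<lambda>x. x \<in> X \<inter> C)"
    using X(2) by (simp only:) (intro comp_intros)
  ultimately show False using tame_computes_no_tree X(3) by blast
qed

text \<open>If all infinite subsets of both sides computed trees, a sequence of conditions meeting
  all requirements would yield one such set on each side, and the requirement for their two programs
  and colours would be violated.\<close>

lemma ex_subset_computing_no_tree:
  "\<exists>H. infinite H \<and> (H \<subseteq> B \<or> H \<subseteq> - B) \<and> (\<forall>p c. \<not> computes_tree p H c)"
proof (rule ccontr)
  assume "\<not> ?thesis"
  then have hyp: "\<exists>p c. computes_tree p H c" if "infinite H" "H \<subseteq> B \<or> H \<subseteq> - B" for H
    using that by blast
  define cond where "cond = (\<lambda>(F0, F1, X, orc). condition B F0 F1 X orc)"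
  \<comment> \<open>Step \<open>n\<close> adds an element at least \<open>n\<close> to each stem and
    meets the requirement for the two programs and two colours coded by \<open>n\<close>.\<close>
  define Q where "Q n c c' \<longleftrightarrow> (case c of (F0, F1, X, orc) \<Rightarrow> case c' of (F0', F1', X', orc') \<Rightarrow>
      extends F0' F1' X' F0 F1 X \<and> (\<exists>x\<ge>n. x \<in> F0') \<and> (\<exists>x\<ge>n. x \<in> F1') \<and>
      avoids B F0' F1' X' (inv rf_code (pfst (pfst n))) (psnd (pfst n) = 1)
        (inv rf_code (pfst (psnd n))) (psnd (psnd n) = 1))"
    for n and c c' :: "nat set \<times> nat set \<times> nat set \<times> (nat \<Rightarrow> nat)"
  have "\<exists>f. \<forall>n. cond (f n) \<and> Q n (f n) (f (Suc n))"
  proof (rule dependent_nat_choice)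
    have "condition B {} {} UNIV zero"
      by (simp add: condition_def tame_zero dec_in_const)
    then show "\<exists>c. cond c" by (auto simp: cond_def)
    show "\<exists>c'. cond c' \<and> Q n c c'" if "cond c" for c n
    proof -
      obtain F0 F1 X orc where c: "c = (F0, F1, X, orc)" by (cases c)
      have cond: "condition B F0 F1 X orc" using that by (simp add: c cond_def)
      have "infinite (X \<inter> B)" "infinite (X \<inter> - B)"
        using condition_infinite[OF cond, of "- B"] condition_infinite[OF cond, of B] hyp by auto
      then obtain x0 x1 where x: "n \<le> x0" "x0 \<in> X \<inter> B" "n \<le> x1" "x1 \<in> X \<inter> - B"
        unfolding infinite_nat_iff_unbounded_le by blast
      \<comment> \<open>Cutting at 0 leaves the reservoir as it is; only the stems grow
        here.\<close>
      have ext: "condition B (F0 \<union> {x0}) (F1 \<union> {x1}) (X \<inter> {0..}) orc"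
        "extends (F0 \<union> {x0}) (F1 \<union> {x1}) (X \<inter> {0..}) F0 F1 X"
        using condition_extend[OF cond, of "{x0}" "{x1}" 0] x by simp_all
      obtain F0' F1' X' orc' where "condition B F0' F1' X' orc'"
        and e: "extends F0' F1' X' (F0 \<union> {x0}) (F1 \<union> {x1}) (X \<inter> {0..})"
        and "avoids B F0' F1' X' (inv rf_code (pfst (pfst n))) (psnd (pfst n) = 1)
          (inv rf_code (pfst (psnd n))) (psnd (psnd n) = 1)"
        using force_avoidance[OF ext(1)] .
      moreover have "x0 \<in> F0'" "x1 \<in> F1'" using e unfolding extends_def by blast+
      ultimately show ?thesis
        using extends_trans[OF e ext(2)] x(1,3)
        by (intro exI[of _ "(F0', F1', X', orc')"]) (auto simp: cond_def Q_def c)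
    qed
  qed
  then obtain f where f: "\<And>n. cond (f n)" "\<And>n. Q n (f n) (f (Suc n))" by blast
  define F0 where "F0 n = fst (f n)" for n
  define F1 where "F1 n = fst (snd (f n))" for n
  define X where "X n = fst (snd (snd (f n)))" for n
  have split: "f n = (F0 n, F1 n, X n, snd (snd (snd (f n))))" for n
    by (simp add: F0_def F1_def X_def)
  have B: "F0 n \<subseteq> B" "F1 n \<subseteq> - B" for n
    using f(1)[of n] by (simp_all add: cond_def condition_def F0_def F1_def split: prod.splits)
  have Q: "extends (F0 (Suc n)) (F1 (Suc n)) (X (Suc n)) (F0 n) (F1 n) (X n)"
    "\<exists>x\<ge>n. x \<in> F0 (Suc n)" "\<exists>x\<ge>n. x \<in> F1 (Suc n)"
    "avoids B (F0 (Suc n)) (F1 (Suc n)) (X (Suc n)) (inv rf_code (pfst (pfst n))) (psnd (pfst n) = 1)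
        (inv rf_code (pfst (psnd n))) (psnd (psnd n) = 1)" for n
    using f(2)[of n] by (simp_all add: Q_def F0_def F1_def X_def split: prod.splits)
  have ext: "extends (F0 (n + k)) (F1 (n + k)) (X (n + k)) (F0 n) (F1 n) (X n)" for n k
  proof (induction k)
    case (Suc k)
    with extends_trans[OF Q(1)[of "n + k"]] show ?case by simp
  qed (simp add: extends_refl)
  have ext': "n \<le> m \<Longrightarrow> extends (F0 m) (F1 m) (X m) (F0 n) (F1 n) (X n)" for n m
    using ext[of n "m - n"] by simp
  let ?H0 = "\<Union>n. F0 n" and ?H1 = "\<Union>n. F1 n"
  have H0: "?H0 \<in> mathias (F0 n) (X n \<inter> B)" and H1: "?H1 \<in> mathias (F1 n) (X n \<inter> - B)" for n
  proof -
    \<comment> \<open>Earlier stems are contained in stem \<open>n\<close>; later ones take new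
      elements only from reservoir \<open>n\<close>, on their own side of the partition.\<close>
    have "F0 m \<subseteq> F0 n \<union> (X n \<inter> B) \<and> F1 m \<subseteq> F1 n \<union> (X n \<inter> - B)" for m
      using ext'[of n m] ext'[of m n] B(1)[of m] B(2)[of m] unfolding extends_def
      by (cases "n \<le> m") auto
    then show "?H0 \<in> mathias (F0 n) (X n \<inter> B)" "?H1 \<in> mathias (F1 n) (X n \<inter> - B)"
      unfolding mathias_def by blast+
  qed
  have "\<exists>x\<ge>m. x \<in> ?H0" "\<exists>x\<ge>m. x \<in> ?H1" for m
    using Q(2,3)[of m] by blast+
  then have "infinite ?H0" "infinite ?H1"
    unfolding infinite_nat_iff_unbounded_le by simp_all
  moreover have "?H0 \<subseteq> B" "?H1 \<subseteq> - B" using B by blast+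
  ultimately obtain p0 c0 p1 c1
    where trees: "computes_tree p0 ?H0 c0" "computes_tree p1 ?H1 c1"
    using hyp by metis
  \<comment> \<open>The step that handled exactly these programs and colours.\<close>
  define n where "n = pair (pair (rf_code p0) (of_bool c0)) (pair (rf_code p1) (of_bool c1))"
  have "inv rf_code (pfst (pfst n)) = p0" "(psnd (pfst n) = 1) = c0"
    "inv rf_code (pfst (psnd n)) = p1" "(psnd (psnd n) = 1) = c1"
    by (simp_all add: n_def inv_f_f[OF inj_rf_code])
  with Q(4)[of n] have "avoids B (F0 (Suc n)) (F1 (Suc n)) (X (Suc n)) p0 c0 p1 c1"
    by simp
  with trees show False
    using H0[of "Suc n"] H1[of "Suc n"] unfolding avoids_def by blast
qed

theorem mainTheorem2:
  shows "\<exists>A0 A1 :: bool list set. A0 \<union> A1 = UNIV \<and> A0 \<inter> A1 = {} \<and>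
           Delta2 (codeset A0) \<and> Delta2 (codeset A1) \<and>
           (\<forall>B0 B1 :: nat set. B0 \<union> B1 = UNIV \<and> B0 \<inter> B1 = {} \<longrightarrow>
              (\<exists>H. infinite H \<and> (H \<subseteq> B0 \<or> H \<subseteq> B1) \<and>
                 \<not> (\<exists>S. tree_iso S \<and> (S \<subseteq> A0 \<or> S \<subseteq> A1) \<and>
                        turing_le (codeset S) H)))"
proof -
  let ?A = "{s. scode s \<in> follower}"
  show ?thesis
  proof (rule exI[of _ ?A], rule exI[of _ "- ?A"], intro conjI allI impI)
    show "?A \<union> - ?A = UNIV" "?A \<inter> - ?A = {}" by auto
    \<comment> \<open>Every number codes a string, so the complement of the set of strings
      corresponds to the complement of the set of codes.\<close>
    have "codeset ?A = follower" "codeset (- ?A) = - follower"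
      using surj_scode unfolding codeset_def by (auto simp: image_iff)
    then show "Delta2 (codeset ?A)" "Delta2 (codeset (- ?A))"
      using Delta2_follower Delta2_Compl_follower by simp_all
    fix B0 B1 :: "nat set"
    assume "B0 \<union> B1 = UNIV \<and> B0 \<inter> B1 = {}"
    then have B1: "B1 = - B0" by blast
    obtain H where H: "infinite H" "H \<subseteq> B0 \<or> H \<subseteq> - B0" "\<forall>p c. \<not> computes_tree p H c"
      using ex_subset_computing_no_tree[of B0] by (elim exE conjE) (rule that)
    have no: False if S: "tree_iso S" "S \<subseteq> ?A \<or> S \<subseteq> - ?A" "turing_le (codeset S) H" for S
    proof -
      from S(2) obtain c where "\<forall>s\<in>S. scode s \<in> follower \<longleftrightarrow> c" by blast
      with S(1,3) have "\<exists>p. computes_tree p H c"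
        unfolding computes_tree_def turing_le_def by blast
      with H(3) show False by blast
    qed
    show "\<exists>H. infinite H \<and> (H \<subseteq> B0 \<or> H \<subseteq> B1) \<and>
      \<not> (\<exists>S. tree_iso S \<and> (S \<subseteq> ?A \<or> S \<subseteq> - ?A) \<and> turing_le (codeset S) H)"
    proof (intro exI[of _ H] conjI notI)
      show "H \<subseteq> B0 \<or> H \<subseteq> B1" using H(2) B1 by simp
      assume "\<exists>S. tree_iso S \<and> (S \<subseteq> ?A \<or> S \<subseteq> - ?A) \<and> turing_le (codeset S) H"
      then show False by (elim exE conjE) (rule no)
    qed (use H(1) in simp)
  qed
qed

end
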